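(* Let $u(x;\vartheta)$ be a scalar-output neural network with $L$ layers under NTK parametrization, let $\vartheta_0,\psi_0\sim\mathcal N(0,I)$ be independent parameter vectors for this architecture, and let $$\tilde g(x;\vartheta_0,\psi_0)=\nabla_{\vartheta_0}u(x;\vartheta_0)^\top\psi_0^*,$$ where $\psi_0^*$ is a copy of $\psi_0$ with all last-layer parameters set to $0$. Let $\mathcal X$ be a finite training set, let $\Theta$ be the (infinite-width) neural tangent kernel of $u$, and assume that $\Theta_{\mathcal X\mathcal X}$ is positive definite. In the infinite-width limit, let $u(\cdot;\vartheta_\infty)$ be the converged ($t\to\infty$) predictor obtained by gradient flow from $u(\cdot;\vartheta_0)$ on $\frac12\|u(\mathcal X;\vartheta_t)-\tilde g(\mathcal X;\vartheta_0,\psi_0)\|_2^2$, where the target $\tilde g(\cdot;\vartheta_0,\psi_0)$ is kept fixed. Then for every finite test set $\mathcal X_T$, the Bayesian RND error $$\epsilon^b(\mathcal X_T;\vartheta_\infty,\vartheta_0,\psi_0)=u(\mathcal X_T;\vartheta_\infty)-\tilde g(\mathcal X_T;\vartheta_0,\psi_0)$$ is Gaussian with zero mean and covariance $$\Sigma^{\epsilon^b}_{\mathcal X_T\mathcal X_T}(\vartheta_\infty,\vartheta_0,\psi_0)=\Theta_{\mathcal X_T\mathcal X_T}-\Theta_{\mathcal X_T\mathcal X}\Theta_{\mathcal X\mathcal X}^{-1}\Theta_{\mathcal X\mathcal X_T}.$$ Thus it recovers the covariance of the exact Bayesian posterior predictive distribution of an infinitely wide neural network with NTK $\Theta$, i.e.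 of the Gaussian process prior $\mathcal{GP}(0,\Theta)$ conditioned on noise-free observations at $\mathcal X$.
   Context: Networks (NTK parametrization). A fully connected network $u(x;\vartheta)$ with $L$ layers and hidden widths $n_1=\dots=n_{L-1}=n$, input dimension $n_0=d_{\rm in}$, is defined by $z^l_i(x)=\sigma_b b^l_i+\frac{\sigma_w}{\sqrt{n_{l-1}}}\sum_{j=1}^{n_{l-1}}w^l_{ij}x^l_j(x)$, $x^1(x)=x$, $x^l_j(x)=\phi(z^{l-1}_j(x))$ for $l\ge2$, $u(x;\vartheta)=z^L(x)$ (scalar output), where $\phi:\mathbb R\to\mathbb R$ is a Lipschitz nonlinearity, $\sigma_w,\sigma_b$ are constants and $\vartheta$ collects all $w^l,b^l$, which are i.i.d. standard normal at initialization. Kernels. The neural tangent kernel (NTK) is $\Theta(x,x')=\lim_{n\to\infty}\nabla_\vartheta u(x;\vartheta_0)^\top\nabla_\vartheta u(x';\vartheta_0)$. It is a known fact, taken as given, that this limit, as well as the limits of the contributions of each layer's parameters, exist in probability and are deterministic. Infinite-width regime (standing convention): the initial functions $(u(\cdot;\vartheta_0),\tilde g(\cdot;\vartheta_0,\psi_0))$ are understood as the joint limit in distribution (of finite-dimensional marginals) as $n\to\infty$; the limit of $u(\cdot;\vartheta_0)$ is a centered Gaussian process with NNGP kernel $\kappa^u(x,x')=\lim_{n\to\infty}\mathbb E[u(x;\vartheta_0)u(x';\vartheta_0)]$. The tangent kernel stays equal to $\Theta$ for all training times, so gradient flow $\frac{d}{dt}\vartheta_t=-\nabla_\vartheta\mathcal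 L(\vartheta_t)$ on $\mathcal L=\frac12\|u(\mathcal X;\vartheta_t)-\mathcal Y\|_2^2$ becomes the linear ODE $\frac{d}{dt}u(x;\vartheta_t)=-\Theta(x,\mathcal X)\,(u(\mathcal X;\vartheta_t)-\mathcal Y)$, started at the limiting initial function. $\vartheta_\infty$ denotes the limit $t\to\infty$ of these infinite-width dynamics. Notation. For finite point sets $A,B$, $u(A)$ is the vector of values and $k_{AB}=(k(a,b))_{a\in A,b\in B}$ for a kernel $k$. *)

theory Defs
  imports "HOL-Probability.Probability"
begin

text \<open>
  Inputs are vectors in \<open>real^'d\<close>, so the input dimension is \<open>CARD('d)\<close>. The neurons of all
  other layers are numbered from 0. \<open>InW i j\<close> is the first-layer weight from input coordinate
  \<open>j\<close> to neuron \<open>i\<close>; \<open>HidW l i j\<close> is the layer-\<open>l\<close> weight for \<open>l \<ge> 2\<close>; \<open>Bias l i\<close> is the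
  layer-\<open>l\<close> bias.
\<close>

datatype 'd param = InW nat 'd | HidW nat nat nat | Bias nat nat

fun param_layer :: "'d param \<Rightarrow> nat" where
  "param_layer (InW i j) = 1"
| "param_layer (HidW l i j) = l"
| "param_layer (Bias l i) = l"

definition layer_width :: "nat \<Rightarrow> nat \<Rightarrow> nat \<Rightarrow> nat" where
  "layer_width L n l = (if l = L then 1 else n)"

definition params :: "nat \<Rightarrow> nat \<Rightarrow> 'd param set" where
  "params L n =
     {InW i j | i j. i < layer_width L n 1} \<union>
     {HidW l i j | l i j. 2 \<le> l \<and> l \<le> L \<and> i < layer_width L n l \<and> j < n} \<union>
     {Bias l i | l i. 1 \<le> l \<and> l \<le> L \<and> i < layer_width L n l}"

text \<open>
  \<open>preact \<phi> \<sigma>\<^sub>w \<sigma>\<^sub>b n \<theta> x l i\<close> is the pre-activation $z^l_i(x)$; layers are counted from 1 and the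
  value at \<open>l = 0\<close> is never used. The input is not passed through \<open>\<phi>\<close>.
\<close>

fun preact ::
  "(real \<Rightarrow> real) \<Rightarrow> real \<Rightarrow> real \<Rightarrow> nat \<Rightarrow> ('d::finite param \<Rightarrow> real) \<Rightarrow> real^'d \<Rightarrow> nat \<Rightarrow> nat \<Rightarrow> real"
where
  "preact \<phi> \<sigma>\<^sub>w \<sigma>\<^sub>b n \<theta> x 0 i = 0"
| "preact \<phi> \<sigma>\<^sub>w \<sigma>\<^sub>b n \<theta> x (Suc 0) i =
     \<sigma>\<^sub>b * \<theta> (Bias 1 i) + \<sigma>\<^sub>w / sqrt (real CARD('d)) * (\<Sum>j\<in>UNIV. \<theta> (InW i j) * x $ j)"
| "preact \<phi> \<sigma>\<^sub>w \<sigma>\<^sub>b n \<theta> x (Suc (Suc l)) i =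
     \<sigma>\<^sub>b * \<theta> (Bias (Suc (Suc l)) i) +
     \<sigma>\<^sub>w / sqrt (real n) * (\<Sum>j<n. \<theta> (HidW (Suc (Suc l)) i j) * \<phi> (preact \<phi> \<sigma>\<^sub>w \<sigma>\<^sub>b n \<theta> x (Suc l) j))"

definition network ::
  "(real \<Rightarrow> real) \<Rightarrow> real \<Rightarrow> real \<Rightarrow> nat \<Rightarrow> nat \<Rightarrow> ('d::finite param \<Rightarrow> real) \<Rightarrow> real^'d \<Rightarrow> real"
where
  "network \<phi> \<sigma>\<^sub>w \<sigma>\<^sub>b L n \<theta> x = preact \<phi> \<sigma>\<^sub>w \<sigma>\<^sub>b n \<theta> x L 0"

text \<open>
  The component of $\nabla_\vartheta u(x;\vartheta)$ belonging to the parameter \<open>p\<close>. The network is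
  locally Lipschitz in its parameters (\<open>\<phi>\<close> is Lipschitz), so this derivative exists for almost every
  \<open>\<theta>\<close>; at the remaining \<open>\<theta>\<close>, \<^const>\<open>deriv\<close> returns a fixed arbitrary number.
\<close>

definition network_grad ::
  "(real \<Rightarrow> real) \<Rightarrow> real \<Rightarrow> real \<Rightarrow> nat \<Rightarrow> nat \<Rightarrow> ('d::finite param \<Rightarrow> real) \<Rightarrow> real^'d \<Rightarrow> 'd param \<Rightarrow> real"
where
  "network_grad \<phi> \<sigma>\<^sub>w \<sigma>\<^sub>b L n \<theta> x p =
     deriv (\<lambda>t. network \<phi> \<sigma>\<^sub>w \<sigma>\<^sub>b L n (\<theta>(p := t)) x) (\<theta> p)"

definition drop_last_layer :: "nat \<Rightarrow> ('d param \<Rightarrow> real) \<Rightarrow> 'd param \<Rightarrow> real" where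
  "drop_last_layer L \<psi> p = (if param_layer p = L then 0 else \<psi> p)"

definition g_tilde ::
  "(real \<Rightarrow> real) \<Rightarrow> real \<Rightarrow> real \<Rightarrow> nat \<Rightarrow> nat \<Rightarrow>
   ('d::finite param \<Rightarrow> real) \<Rightarrow> ('d param \<Rightarrow> real) \<Rightarrow> real^'d \<Rightarrow> real"
where
  "g_tilde \<phi> \<sigma>\<^sub>w \<sigma>\<^sub>b L n \<theta> \<psi> x =
     (\<Sum>p\<in>params L n. network_grad \<phi> \<sigma>\<^sub>w \<sigma>\<^sub>b L n \<theta> x p * drop_last_layer L \<psi> p)"

definition init_measure :: "nat \<Rightarrow> nat \<Rightarrow> ('d param \<Rightarrow> real) measure" where
  "init_measure L n = PiM (params L n) (\<lambda>_. density lborel std_normal_density)"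

definition tendsto_in_prob :: "(nat \<Rightarrow> 'a measure) \<Rightarrow> (nat \<Rightarrow> 'a \<Rightarrow> real) \<Rightarrow> real \<Rightarrow> bool" where
  "tendsto_in_prob M X c \<longleftrightarrow>
     (\<forall>e>0. (\<lambda>n. measure (M n) {\<omega> \<in> space (M n). e < \<bar>X n \<omega> - c\<bar>}) \<longlonglongrightarrow> 0)"

definition empirical_ntk ::
  "(real \<Rightarrow> real) \<Rightarrow> real \<Rightarrow> real \<Rightarrow> nat \<Rightarrow> nat \<Rightarrow>
   ('d::finite param \<Rightarrow> real) \<Rightarrow> real^'d \<Rightarrow> real^'d \<Rightarrow> real"
where
  "empirical_ntk \<phi> \<sigma>\<^sub>w \<sigma>\<^sub>b L n \<theta> x x' =
     (\<Sum>p\<in>params L n. network_grad \<phi> \<sigma>\<^sub>w \<sigma>\<^sub>b L n \<theta> x p * network_grad \<phi> \<sigma>\<^sub>w \<sigma>\<^sub>b L n \<theta> x' p)"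

definition empirical_layer_ntk ::
  "(real \<Rightarrow> real) \<Rightarrow> real \<Rightarrow> real \<Rightarrow> nat \<Rightarrow> nat \<Rightarrow> nat \<Rightarrow>
   ('d::finite param \<Rightarrow> real) \<Rightarrow> real^'d \<Rightarrow> real^'d \<Rightarrow> real"
where
  "empirical_layer_ntk \<phi> \<sigma>\<^sub>w \<sigma>\<^sub>b L n l \<theta> x x' =
     (\<Sum>p\<in>{p \<in> params L n. param_layer p = l}.
        network_grad \<phi> \<sigma>\<^sub>w \<sigma>\<^sub>b L n \<theta> x p * network_grad \<phi> \<sigma>\<^sub>w \<sigma>\<^sub>b L n \<theta> x' p)"

definition is_ntk ::
  "(real \<Rightarrow> real) \<Rightarrow> real \<Rightarrow> real \<Rightarrow> nat \<Rightarrow> (real^'d::finite \<Rightarrow> real^'d \<Rightarrow> real) \<Rightarrow> bool"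
where
  "is_ntk \<phi> \<sigma>\<^sub>w \<sigma>\<^sub>b L \<Theta> \<longleftrightarrow>
     (\<forall>x x'. tendsto_in_prob (init_measure L)
        (\<lambda>n \<theta>. empirical_ntk \<phi> \<sigma>\<^sub>w \<sigma>\<^sub>b L n \<theta> x x') (\<Theta> x x'))"

definition layer_ntk_limits_exist ::
  "'d::finite itself \<Rightarrow> (real \<Rightarrow> real) \<Rightarrow> real \<Rightarrow> real \<Rightarrow> nat \<Rightarrow> bool"
where
  "layer_ntk_limits_exist _ \<phi> \<sigma>\<^sub>w \<sigma>\<^sub>b L \<longleftrightarrow>
     (\<forall>l\<in>{1..L}. \<forall>x x' :: real^'d. \<exists>c. tendsto_in_prob (init_measure L)
        (\<lambda>n \<theta>. empirical_layer_ntk \<phi> \<sigma>\<^sub>w \<sigma>\<^sub>b L n l \<theta> x x') c)"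

text \<open>
  Convergence in distribution of all finite-dimensional marginals. The marginal on a finite index set
  \<open>I\<close> takes values in the space of functions on \<open>I\<close> with the product topology (functions being
  extended by \<^const>\<open>undefined\<close> outside \<open>I\<close>), and weak convergence is tested on bounded continuous
  functions on that space.
\<close>

definition fidi_converges ::
  "(nat \<Rightarrow> 'a measure) \<Rightarrow> (nat \<Rightarrow> 'i \<Rightarrow> 'a \<Rightarrow> 'b::topological_space) \<Rightarrow>
   'w measure \<Rightarrow> ('i \<Rightarrow> 'w \<Rightarrow> 'b) \<Rightarrow> bool"
where
  "fidi_converges M X N Y \<longleftrightarrow>
     (\<forall>I f. finite I \<and> continuous_map (product_topology (\<lambda>_. euclidean) I) euclideanreal f \<and>
        bounded (f ` (I \<rightarrow>\<^sub>E UNIV)) \<longrightarrow>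
        (\<lambda>n. \<integral>\<omega>. f (\<lambda>i\<in>I. X n i \<omega>) \<partial>M n) \<longlonglongrightarrow> (\<integral>\<omega>. f (\<lambda>i\<in>I. Y i \<omega>) \<partial>N))"

text \<open>
  The process \<open>(U, G)\<close> on \<open>P\<close> is the infinite-width limit of $(u(\cdot;\vartheta_0),
  \tilde g(\cdot;\vartheta_0,\psi_0))$ for independent \<open>\<theta>\<^sub>0\<close>, \<open>\<psi>\<^sub>0\<close>.
\<close>

definition infinite_width_limit ::
  "(real \<Rightarrow> real) \<Rightarrow> real \<Rightarrow> real \<Rightarrow> nat \<Rightarrow>
   'w measure \<Rightarrow> (real^'d::finite \<Rightarrow> 'w \<Rightarrow> real) \<Rightarrow> (real^'d \<Rightarrow> 'w \<Rightarrow> real) \<Rightarrow> bool"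
where
  "infinite_width_limit \<phi> \<sigma>\<^sub>w \<sigma>\<^sub>b L P U G \<longleftrightarrow>
     prob_space P \<and> (\<forall>x. U x \<in> borel_measurable P \<and> G x \<in> borel_measurable P) \<and>
     fidi_converges
       (\<lambda>n. init_measure L n \<Otimes>\<^sub>M init_measure L n)
       (\<lambda>n x (\<theta>, \<psi>). (network \<phi> \<sigma>\<^sub>w \<sigma>\<^sub>b L n \<theta> x, g_tilde \<phi> \<sigma>\<^sub>w \<sigma>\<^sub>b L n \<theta> \<psi> x))
       P (\<lambda>x \<omega>. (U x \<omega>, G x \<omega>))"

text \<open>
  Gradient flow in the infinite-width regime for training inputs \<open>X j\<close> with fixed targets \<open>y j\<close>;
  \<open>f t x\<close> is the prediction at \<open>x\<close> at time \<open>t\<close>.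
\<close>

definition ntk_gradient_flow ::
  "('x \<Rightarrow> 'x \<Rightarrow> real) \<Rightarrow> ('m::finite \<Rightarrow> 'x) \<Rightarrow> ('m \<Rightarrow> real) \<Rightarrow> (real \<Rightarrow> 'x \<Rightarrow> real) \<Rightarrow> bool"
where
  "ntk_gradient_flow \<Theta> X y f \<longleftrightarrow>
     (\<forall>x. \<forall>t\<ge>0. ((\<lambda>s. f s x) has_real_derivative
        - (\<Sum>j\<in>UNIV. \<Theta> x (X j) * (f t (X j) - y j))) (at t within {0..}))"

definition kernel_matrix ::
  "('x \<Rightarrow> 'x \<Rightarrow> real) \<Rightarrow> ('a::finite \<Rightarrow> 'x) \<Rightarrow> ('b::finite \<Rightarrow> 'x) \<Rightarrow> real^'b^'a"
where
  "kernel_matrix k A B = (\<chi> i j. k (A i) (B j))"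

definition positive_definite :: "real^'m^'m \<Rightarrow> bool" where
  "positive_definite A \<longleftrightarrow> transpose A = A \<and> (\<forall>v. v \<noteq> 0 \<longrightarrow> 0 < v \<bullet> (A *v v))"

text \<open>Degenerate normal distributions are included as \<open>v = 0\<close>.\<close>

definition normal_law :: "real \<Rightarrow> real \<Rightarrow> real measure" where
  "normal_law m v = (if v = 0 then return borel m else density lborel (normal_density m (sqrt v)))"

text \<open>For a finite index type this says that the random vector is multivariate normal.\<close>

definition gaussian_process :: "'w measure \<Rightarrow> ('i \<Rightarrow> 'w \<Rightarrow> real) \<Rightarrow> bool" where
  "gaussian_process M X \<longleftrightarrow>
     (\<forall>i. X i \<in> borel_measurable M) \<and>
     (\<forall>I a. finite I \<longrightarrow> (\<exists>m v. 0 \<le> v \<and> distr M borel (\<lambda>\<omega>. \<Sum>i\<in>I. a i * X i \<omega>) = normal_law m v))"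

definition has_covariance ::
  "'w measure \<Rightarrow> ('w \<Rightarrow> real) \<Rightarrow> ('w \<Rightarrow> real) \<Rightarrow> real \<Rightarrow> bool"
where
  "has_covariance M X Y c \<longleftrightarrow>
     X \<in> borel_measurable M \<and> Y \<in> borel_measurable M \<and>
     integrable M (\<lambda>\<omega>. (X \<omega>)\<^sup>2) \<and> integrable M (\<lambda>\<omega>. (Y \<omega>)\<^sup>2) \<and>
     (\<integral>\<omega>. (X \<omega> - (\<integral>\<omega>'. X \<omega>' \<partial>M)) * (Y \<omega> - (\<integral>\<omega>'. Y \<omega>' \<partial>M)) \<partial>M) = c"

definition centered_gaussian_process ::
  "'w measure \<Rightarrow> ('i \<Rightarrow> 'w \<Rightarrow> real) \<Rightarrow> ('i \<Rightarrow> 'i \<Rightarrow> real) \<Rightarrow> bool"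
where
  "centered_gaussian_process M X k \<longleftrightarrow>
     gaussian_process M X \<and> (\<forall>i. (\<integral>\<omega>. X i \<omega> \<partial>M) = 0) \<and> (\<forall>i j. has_covariance M (X i) (X j) (k i j))"

text \<open>\<open>\<kappa> y\<close> is (a version of) the conditional distribution of \<open>Y\<close> given \<open>X = y\<close>.\<close>

definition regular_conditional_distribution ::
  "'w measure \<Rightarrow> ('w \<Rightarrow> 'a::topological_space) \<Rightarrow> ('w \<Rightarrow> 'b::topological_space) \<Rightarrow>
   ('a \<Rightarrow> 'b measure) \<Rightarrow> bool"
where
  "regular_conditional_distribution M X Y \<kappa> \<longleftrightarrow>
     \<kappa> \<in> borel \<rightarrow>\<^sub>M prob_algebra borel \<and>
     (\<forall>A\<in>sets borel. \<forall>B\<in>sets borel.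
        emeasure M {\<omega> \<in> space M. X \<omega> \<in> A \<and> Y \<omega> \<in> B} =
        (\<integral>\<^sup>+y\<in>A. emeasure (\<kappa> y) B \<partial>distr M borel X))"

end

theory Submission
  imports Defs
begin

text \<open>
  Let \<open>D = U - G\<close>. At finite width, \<open>g_tilde\<close> is, given \<open>\<theta>\<close>, Gaussian in \<open>\<psi>\<close> with
  covariance the empirical tangent kernel of the hidden layers, which tends to a constant; the
  network is, given its hidden layers, Gaussian in the last-layer parameters with covariance the
  empirical tangent kernel of the last layer. Hence the characteristic functions factorize in the
  limit, the two covariances add up to \<open>\<Theta>\<close>, and \<open>D\<close> is a centered Gaussian process with kernel \<open>\<Theta>\<close>.
  The linear gradient flow turns \<open>D\<close> into \<open>D(x) - \<Theta>(x, X) \<Theta>(X, X)\<inverse> D(X)\<close>, the residual of the linear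
  regression of \<open>D(x)\<close> on \<open>D(X)\<close>. For every centered Gaussian process with kernel \<open>\<Theta>\<close> this residual has
  covariance \<open>\<Sigma>\<close> and is uncorrelated with, hence independent of, the observations, so that \<open>\<Sigma>\<close> is
  also the conditional covariance.
\<close>

section \<open>Gaussian laws and Gaussian processes\<close>

text \<open>\<open>network\<close> and \<open>g_tilde\<close> share the same \<theta>, so neither
  independence nor a joint Gaussian law is at hand at finite width. The order of integration
  resolves this: \<psi> first, which leaves the phase of the network times a factor that
  concentrates, and only then the last layer. Both are exact Gaussian integrals at every width; the
  asymptotics come from the limits of the tangent kernels. Dropping the last layer from \<psi> makes
  the shares add up, because the network itself contributes that layer's share.

  Convergence of finite-dimensional marginals does not give convergence of moments, so means and
  covariances are read off the limiting characteristic function. Densities of the random vectors are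
  avoided: test points may repeat or coincide with training points, and \<Sigma> is then singular.
  Conditioning therefore goes through independence of the residual, which calls for uniqueness of
  characteristic functions in several dimensions.\<close>

lemma normal_law_eq_distr_std:
  assumes "0 \<le> v"
  shows "normal_law m v = distr std_normal_distribution borel (\<lambda>x. m + sqrt v * x)"
proof (cases "v = 0")
  case True
  interpret prob_space std_normal_distribution
    by (intro prob_space_normal_density) simp
  show ?thesis
    using True by (simp add: normal_law_def distr_const)
next
  case False
  interpret prob_space std_normal_distribution
    by (intro prob_space_normal_density) simp
  have "distributed std_normal_distribution lborel (\<lambda>x. x) std_normal_density"
    by (auto simp: distributed_def distr_id2 normal_density_nonneg)
  from normal_density_affine[OF this, of "sqrt v" m] False assms
  have "distributed std_normal_distribution lborel (\<lambda>x. m + sqrt v * x) (normal_density m (sqrt v))"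
    by simp
  from distributed_distr_eq_density[OF this] False
  have "normal_law m v = distr std_normal_distribution lborel (\<lambda>x. m + sqrt v * x)"
    by (simp add: normal_law_def)
  also have "\<dots> = distr std_normal_distribution borel (\<lambda>x. m + sqrt v * x)"
    by (rule distr_cong) auto
  finally show ?thesis .
qed

lemma real_distribution_normal_law: "0 \<le> v \<Longrightarrow> real_distribution (normal_law m v)"
  unfolding normal_law_eq_distr_std
  by (intro prob_space.real_distribution_distr prob_space_normal_density) auto

lemma char_normal_law:
  assumes "0 \<le> v"
  shows "char (normal_law 0 v) t = complex_of_real (exp (- v * t\<^sup>2 / 2))"
proof -
  have "char (normal_law 0 v) t = char std_normal_distribution (t * sqrt v)"
    unfolding normal_law_eq_distr_std[OF assms]
    by (simp add: char_def integral_distr mult.assoc)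
  then show ?thesis
    using assms by (simp add: char_std_normal_distribution power_mult_distrib mult.commute)
qed

lemma normal_law_moments:
  assumes "0 \<le> v"
  shows "integrable (normal_law m v) (\<lambda>x. x)" "integrable (normal_law m v) (\<lambda>x. x\<^sup>2)"
    "(\<integral>x. x \<partial>normal_law m v) = m" "(\<integral>x. x\<^sup>2 \<partial>normal_law m v) = m\<^sup>2 + v"
proof -
  interpret prob_space std_normal_distribution
    by (intro prob_space_normal_density) simp
  have i1 [simp]: "integrable std_normal_distribution (\<lambda>x. x)"
    using integrable_std_normal_distribution_moment[of 1] by simp
  have i2 [simp]: "integrable std_normal_distribution (\<lambda>x. x\<^sup>2)"
    using integrable_std_normal_distribution_moment[of 2] by simp
  have e1: "(\<integral>x. x \<partial>std_normal_distribution) = 0"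
    using integral_std_normal_distribution_moment_odd[of 1] by simp
  have e2: "(\<integral>x. x\<^sup>2 \<partial>std_normal_distribution) = 1"
    using integral_std_normal_moment_even[of 1]
    by (simp add: integral_density normal_density_nonneg)
  have sq: "(m + sqrt v * x)\<^sup>2 = m\<^sup>2 + 2 * m * sqrt v * x + v * x\<^sup>2" for x
    using assms by (simp add: power2_sum power_mult_distrib algebra_simps)
  show "integrable (normal_law m v) (\<lambda>x. x)" "(\<integral>x. x \<partial>normal_law m v) = m"
    unfolding normal_law_eq_distr_std[OF assms]
    by (simp_all add: integrable_distr_eq integral_distr e1 prob_space[simplified])
  show "integrable (normal_law m v) (\<lambda>x. x\<^sup>2)"
    unfolding normal_law_eq_distr_std[OF assms]
    by (simp add: integrable_distr_eq sq)
  show "(\<integral>x. x\<^sup>2 \<partial>normal_law m v) = m\<^sup>2 + v"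
    unfolding normal_law_eq_distr_std[OF assms]
    by (simp add: integral_distr sq e1 e2 prob_space[simplified])
qed

lemma distr_eq_normal_lawI:
  assumes "prob_space M" and X [measurable]: "X \<in> borel_measurable M" and "0 \<le> v"
    and ch: "\<And>t. (\<integral>\<omega>. iexp (t * X \<omega>) \<partial>M) = complex_of_real (exp (- v * t\<^sup>2 / 2))"
  shows "distr M borel X = normal_law 0 v"
proof (rule Levy_uniqueness)
  show "real_distribution (distr M borel X)"
    by (rule prob_space.real_distribution_distr[OF assms(1) X])
  show "real_distribution (normal_law 0 v)"
    by (rule real_distribution_normal_law[OF assms(3)])
  show "char (distr M borel X) = char (normal_law 0 v)"
  proof
    fix t
    have "char (distr M borel X) t = (\<integral>\<omega>. iexp (t * X \<omega>) \<partial>M)"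
      by (simp add: char_def integral_distr)
    then show "char (distr M borel X) t = char (normal_law 0 v) t"
      unfolding ch char_normal_law[OF assms(3)] .
  qed
qed

lemma moments_of_normal_law:
  assumes X [measurable]: "X \<in> borel_measurable M" and d: "distr M borel X = normal_law m v" and "0 \<le> v"
  shows "integrable M X" "integrable M (\<lambda>\<omega>. (X \<omega>)\<^sup>2)" "(\<integral>\<omega>. X \<omega> \<partial>M) = m" "(\<integral>\<omega>. (X \<omega>)\<^sup>2 \<partial>M) = m\<^sup>2 + v"
proof -
  note * = normal_law_moments[OF assms(3), of m, folded d]
  show "integrable M X" "integrable M (\<lambda>\<omega>. (X \<omega>)\<^sup>2)" "(\<integral>\<omega>. X \<omega> \<partial>M) = m" "(\<integral>\<omega>. (X \<omega>)\<^sup>2 \<partial>M) = m\<^sup>2 + v"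
    using * by (simp_all add: integrable_distr_eq integral_distr)
qed

section \<open>Second moments and covariances\<close>

lemma integrable_mult_of_squares:
  fixes X Y :: "'a \<Rightarrow> real"
  assumes [measurable]: "X \<in> borel_measurable M" "Y \<in> borel_measurable M"
    and "integrable M (\<lambda>\<omega>. (X \<omega>)\<^sup>2)" "integrable M (\<lambda>\<omega>. (Y \<omega>)\<^sup>2)"
  shows "integrable M (\<lambda>\<omega>. X \<omega> * Y \<omega>)"
proof (rule Bochner_Integration.integrable_bound)
  show "integrable M (\<lambda>\<omega>. (X \<omega>)\<^sup>2 + (Y \<omega>)\<^sup>2)"
    using assms by simp
  have "\<bar>x * y\<bar> \<le> x\<^sup>2 + y\<^sup>2" for x y :: real
  proof -
    have "2 * \<bar>x\<bar> * \<bar>y\<bar> \<le> \<bar>x\<bar>\<^sup>2 + \<bar>y\<bar>\<^sup>2"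
      by (rule sum_squares_bound)
    moreover have "0 \<le> \<bar>x\<bar> * \<bar>y\<bar>" by simp
    moreover have "\<bar>x\<bar>\<^sup>2 = x\<^sup>2" "\<bar>y\<bar>\<^sup>2 = y\<^sup>2" by simp_all
    ultimately show ?thesis unfolding abs_mult by linarith
  qed
  then show "AE \<omega> in M. norm (X \<omega> * Y \<omega>) \<le> norm ((X \<omega>)\<^sup>2 + (Y \<omega>)\<^sup>2)"
    by auto
qed measurable

lemma has_covariance_centered_iff:
  assumes "(\<integral>\<omega>. X \<omega> \<partial>M) = 0" "(\<integral>\<omega>. Y \<omega> \<partial>M) = 0"
  shows "has_covariance M X Y c \<longleftrightarrow>
     X \<in> borel_measurable M \<and> Y \<in> borel_measurable M \<and>
     integrable M (\<lambda>\<omega>. (X \<omega>)\<^sup>2) \<and> integrable M (\<lambda>\<omega>. (Y \<omega>)\<^sup>2) \<and> (\<integral>\<omega>. X \<omega> * Y \<omega> \<partial>M) = c"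
  using assms by (simp add: has_covariance_def)

lemma has_covariance_add_const:
  assumes "prob_space M" "has_covariance M X Y c"
  shows "has_covariance M (\<lambda>\<omega>. X \<omega> + a) (\<lambda>\<omega>. Y \<omega> + b) c"
proof -
  interpret prob_space M by fact
  have [measurable]: "X \<in> borel_measurable M" "Y \<in> borel_measurable M"
    and sq [simp]: "integrable M (\<lambda>\<omega>. (X \<omega>)\<^sup>2)" "integrable M (\<lambda>\<omega>. (Y \<omega>)\<^sup>2)"
    using assms(2) by (auto simp: has_covariance_def)
  have i [simp]: "integrable M X" "integrable M Y"
    using sq by (auto intro: square_integrable_imp_integrable)
  have "integrable M (\<lambda>\<omega>. (X \<omega> + a)\<^sup>2)" "integrable M (\<lambda>\<omega>. (Y \<omega> + b)\<^sup>2)"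
    by (simp_all add: power2_sum)
  then show ?thesis
    using assms(2) by (auto simp: has_covariance_def prob_space)
qed

text \<open>Polarization: the characteristic functions of the linear combinations determine all covariances.\<close>

lemma centered_gaussian_processI:
  fixes X :: "'i \<Rightarrow> 'w \<Rightarrow> real"
  assumes "prob_space M" and X: "\<And>i. X i \<in> borel_measurable M"
    and sym: "\<And>i j. k i j = k j i"
    and ch: "\<And>I a. finite I \<Longrightarrow> (\<integral>\<omega>. iexp (\<Sum>i\<in>I. a i * X i \<omega>) \<partial>M) =
        complex_of_real (exp (- (\<Sum>i\<in>I. \<Sum>j\<in>I. a i * a j * k i j) / 2))"
  shows "centered_gaussian_process M X k"
proof -
  note [measurable] = X
  \<comment> \<open>A characteristic function has modulus at most 1, so exp(-q/2) \<le> 1 forces q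
    \<ge> 0: positive semidefiniteness of \<open>k\<close> is contained in
    \<open>ch\<close>.\<close>
  have pos: "0 \<le> (\<Sum>i\<in>I. \<Sum>j\<in>I. a i * a j * k i j)" if "finite I" for I a
  proof -
    interpret prob_space M by fact
    have "norm (\<integral>\<omega>. iexp (\<Sum>i\<in>I. a i * X i \<omega>) \<partial>M) \<le> (\<integral>\<omega>. norm (iexp (\<Sum>i\<in>I. a i * X i \<omega>)) \<partial>M)"
      by (rule integral_norm_bound)
    then show ?thesis
      unfolding ch[OF that] by (simp add: prob_space)
  qed
  have law: "distr M borel (\<lambda>\<omega>. \<Sum>i\<in>I. a i * X i \<omega>) = normal_law 0 (\<Sum>i\<in>I. \<Sum>j\<in>I. a i * a j * k i j)"
    if "finite I" for I a
  proof (rule distr_eq_normal_lawI[OF assms(1)])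
    fix t
    show "(\<integral>\<omega>. iexp (t * (\<Sum>i\<in>I. a i * X i \<omega>)) \<partial>M) =
        complex_of_real (exp (- (\<Sum>i\<in>I. \<Sum>j\<in>I. a i * a j * k i j) * t\<^sup>2 / 2))"
    proof -
      have "t * (\<Sum>i\<in>I. a i * X i \<omega>) = (\<Sum>i\<in>I. (t * a i) * X i \<omega>)" for \<omega>
        by (simp add: sum_distrib_left mult.assoc)
      moreover have "- (\<Sum>i\<in>I. \<Sum>j\<in>I. a i * a j * k i j) * t\<^sup>2 =
          - (\<Sum>i\<in>I. \<Sum>j\<in>I. (t * a i) * (t * a j) * k i j)"
        unfolding minus_mult_left[symmetric] sum_distrib_right power2_eq_square by (simp add: mult_ac)
      ultimately show ?thesis
        using ch[OF that, of "\<lambda>i. t * a i"] by simp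
    qed
  qed (use pos[OF that] in auto)
  have v: "distr M borel (X i) = normal_law 0 (k i i)" "0 \<le> k i i" for i
    using law[of "{i}" "\<lambda>_. 1"] pos[of "{i}" "\<lambda>_. 1"] by simp_all
  note m = moments_of_normal_law[OF X v]
  have mean [simp]: "(\<integral>\<omega>. X i \<omega> \<partial>M) = 0" for i
    by (rule m)
  have "(\<integral>\<omega>. X i \<omega> * X j \<omega> \<partial>M) = k i j" for i j
  proof (cases "i = j")
    case True
    then show ?thesis using m(4)[of i] by (simp add: power2_eq_square)
  next
    \<comment> \<open>The variance of \<open>X i + X j\<close> contains the mixed moment. For equal
      indices \<open>{i, j}\<close> has one element only, and \<open>law\<close> would not speak of
      this sum.\<close>
    case False
    have "distr M borel (\<lambda>\<omega>. X i \<omega> + X j \<omega>) = normal_law 0 (k i i + 2 * k i j + k j j)"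
      and p: "0 \<le> k i i + 2 * k i j + k j j"
      using law[of "{i, j}" "\<lambda>_. 1"] pos[of "{i, j}" "\<lambda>_. 1"] False sym[of i j] by (simp_all add: algebra_simps)
    from moments_of_normal_law(4)[OF _ this]
    have "(\<integral>\<omega>. (X i \<omega> + X j \<omega>)\<^sup>2 \<partial>M) = k i i + 2 * k i j + k j j"
      by simp
    moreover have "(\<integral>\<omega>. (X i \<omega> + X j \<omega>)\<^sup>2 \<partial>M) =
      (\<integral>\<omega>. (X i \<omega>)\<^sup>2 \<partial>M) + (\<integral>\<omega>. (X j \<omega>)\<^sup>2 \<partial>M) + 2 * (\<integral>\<omega>. X i \<omega> * X j \<omega> \<partial>M)"
      by (simp add: power2_sum m integrable_mult_of_squares mult.assoc)
    ultimately show ?thesis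
      by (simp add: m)
  qed
  then have "has_covariance M (X i) (X j) (k i j)" for i j
    by (simp add: has_covariance_centered_iff m)
  moreover have "gaussian_process M X"
    unfolding gaussian_process_def
  proof (intro conjI allI impI)
    fix I :: "'i set" and a :: "'i \<Rightarrow> real"
    assume "finite I"
    from pos[OF this] law[OF this]
    show "\<exists>m v. 0 \<le> v \<and> distr M borel (\<lambda>\<omega>. \<Sum>i\<in>I. a i * X i \<omega>) = normal_law m v"
      by (intro exI conjI)
  qed (rule X)
  ultimately show ?thesis
    by (simp add: centered_gaussian_process_def)
qed

text \<open>The points \<open>Y j\<close> need not be distinct.\<close>

lemma centered_gaussian_process_char:
  assumes "prob_space M" and gp: "centered_gaussian_process M F k" and J: "finite J"
  shows "(\<integral>\<omega>. iexp (\<Sum>j\<in>J. a j * F (Y j) \<omega>) \<partial>M) =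
      complex_of_real (exp (- (\<Sum>i\<in>J. \<Sum>j\<in>J. a i * a j * k (Y i) (Y j)) / 2))"
proof -
  interpret prob_space M by fact
  have F [measurable]: "F i \<in> borel_measurable M" and mean: "(\<integral>\<omega>. F i \<omega> \<partial>M) = 0" for i
    using gp by (auto simp: centered_gaussian_process_def gaussian_process_def)
  then have sq: "integrable M (\<lambda>\<omega>. (F i \<omega>)\<^sup>2)" and cov: "(\<integral>\<omega>. F i \<omega> * F j \<omega> \<partial>M) = k i j" for i j
    using gp by (auto simp: centered_gaussian_process_def has_covariance_centered_iff)
  have i [simp]: "integrable M (F i)" for i
    using sq by (auto intro: square_integrable_imp_integrable)
  have ip [simp]: "integrable M (\<lambda>\<omega>. F i \<omega> * F j \<omega>)" for i j
    using sq by (auto intro: integrable_mult_of_squares)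
  define S where "S \<omega> = (\<Sum>j\<in>J. a j * F (Y j) \<omega>)" for \<omega>
  have [measurable]: "S \<in> borel_measurable M"
    unfolding S_def by measurable
  \<comment> \<open>\<open>gaussian_process\<close> sums over sets of indices, so the coefficients
    of repeated points are first added up.\<close>
  have "S \<omega> = (\<Sum>p\<in>Y ` J. (\<Sum>j\<in>{j\<in>J. Y j = p}. a j) * F p \<omega>)" for \<omega>
    unfolding S_def sum.image_gen[OF J, where g = Y] by (intro sum.cong) (auto simp: sum_distrib_right)
  then have S': "S = (\<lambda>\<omega>. \<Sum>p\<in>Y ` J. (\<Sum>j\<in>{j\<in>J. Y j = p}. a j) * F p \<omega>)"
    by (rule ext)
  have "\<exists>m v. 0 \<le> v \<and> distr M borel S = normal_law m v"
    unfolding S' using gp J unfolding centered_gaussian_process_def gaussian_process_def by simp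
  then obtain m v where v: "0 \<le> v" and d: "distr M borel S = normal_law m v"
    by blast
  have m: "m = 0"
    using moments_of_normal_law(3)[OF _ d v] by (simp add: S_def mean)
  \<comment> \<open>The variance \<open>v\<close> is so far anonymous; comparing two expressions for
    the second moment of \<open>S\<close> identifies it.\<close>
  have "(\<integral>\<omega>. (S \<omega>)\<^sup>2 \<partial>M) = (\<integral>\<omega>. (\<Sum>i\<in>J. \<Sum>j\<in>J. a i * a j * (F (Y i) \<omega> * F (Y j) \<omega>)) \<partial>M)"
    unfolding S_def power2_eq_square sum_product by (simp only: mult_ac)
  also have "\<dots> = (\<Sum>i\<in>J. \<Sum>j\<in>J. a i * a j * k (Y i) (Y j))"
    by (simp add: cov)
  finally have v': "v = (\<Sum>i\<in>J. \<Sum>j\<in>J. a i * a j * k (Y i) (Y j))"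
    using moments_of_normal_law(4)[OF _ d v] m by simp
  have "(\<integral>\<omega>. iexp (S \<omega>) \<partial>M) = char (distr M borel S) 1"
    by (simp add: char_def integral_distr)
  also have "\<dots> = complex_of_real (exp (- v / 2))"
    unfolding d m char_normal_law[OF v] by simp
  finally show ?thesis
    unfolding S_def v' .
qed

section \<open>Uniqueness of characteristic functions on Euclidean spaces\<close>

text \<open>Normalizing \<open>w\<close> to a probability density turns the hypothesis into equality
  of two characteristic functions on the real line. The weight is what allows an induction over
  coordinates to carry along the coordinates already treated.\<close>

lemma weighted_Levy_uniqueness:
  fixes f w :: "'a \<Rightarrow> real"
  assumes "prob_space M" "prob_space N" and sets: "sets N = sets M"
    and f [measurable]: "f \<in> borel_measurable M"
    and w [measurable]: "w \<in> borel_measurable M" and w_nonneg: "\<And>x. 0 \<le> w x" and w_le: "\<And>x. w x \<le> C"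
    and ch: "\<And>s. (\<integral>x. w x *\<^sub>R iexp (s * f x) \<partial>M) = (\<integral>x. w x *\<^sub>R iexp (s * f x) \<partial>N)"
    and A [measurable]: "A \<in> sets borel"
  shows "(\<integral>x. w x * indicator A (f x) \<partial>M) = (\<integral>x. w x * indicator A (f x) \<partial>N)"
proof -
  interpret M: prob_space M by fact
  interpret N: prob_space N by fact
  have [measurable]: "f \<in> borel_measurable N" "w \<in> borel_measurable N"
    using f w by (simp_all add: measurable_cong_sets[OF sets refl])
  have [simp]: "integrable M w" "integrable N w"
    using w_nonneg w_le by (auto intro!: M.integrable_const_bound[of _ C] N.integrable_const_bound[of _ C])
  define c where "c = (\<integral>x. w x \<partial>M)"
  \<comment> \<open>Frequency 0 shows that both total weights agree, so one constant
    \<open>c\<close> normalizes both measures.\<close>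
  have "complex_of_real (\<integral>x. w x \<partial>M) = complex_of_real (\<integral>x. w x \<partial>N)"
    using ch[of 0] by (simp add: scaleR_conv_of_real)
  then have c': "(\<integral>x. w x \<partial>N) = c"
    by (simp add: c_def)
  show ?thesis
  proof (cases "c = 0")
    \<comment> \<open>A weight of total mass 0 cannot be normalized, but it vanishes almost
      everywhere.\<close>
    case True
    have "AE x in M. w x = 0" "AE x in N. w x = 0"
      using True c' w_nonneg
      by (simp_all add: c_def integral_nonneg_eq_0_iff_AE[symmetric])
    then have "(\<integral>x. w x * indicator A (f x) \<partial>M) = 0" "(\<integral>x. w x * indicator A (f x) \<partial>N) = 0"
      by (auto intro!: integral_eq_zero_AE)
    then show ?thesis by simp
  next
    case False
    moreover have "0 \<le> c"
      unfolding c_def by (simp add: w_nonneg)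
    ultimately have c: "0 < c" by simp
    have *: "prob_space (density Q (\<lambda>x. ennreal (w x / c)))"
      if [measurable]: "w \<in> borel_measurable Q" and "integrable Q w" "(\<integral>x. w x \<partial>Q) = c" for Q
    proof (rule prob_spaceI)
      have "emeasure (density Q (\<lambda>x. ennreal (w x / c))) (space Q) = (\<integral>\<^sup>+x. ennreal (w x / c) \<partial>Q)"
        by (simp add: emeasure_density cong: nn_integral_cong)
      also have "\<dots> = ennreal (\<integral>x. w x / c \<partial>Q)"
        using that w_nonneg c by (intro nn_integral_eq_integral) auto
      finally show "emeasure (density Q (\<lambda>x. ennreal (w x / c))) (space (density Q (\<lambda>x. ennreal (w x / c)))) = 1"
        using that c by simp
    qed
    define DM where "DM = distr (density M (\<lambda>x. ennreal (w x / c))) borel f"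
    define DN where "DN = distr (density N (\<lambda>x. ennreal (w x / c))) borel f"
    have "char DM s = char DN s" for s
    proof -
      have "char DM s = (\<integral>x. (w x / c) *\<^sub>R iexp (s * f x) \<partial>M)"
        using w_nonneg c unfolding DM_def char_def
        by (subst integral_distr) (auto simp: integral_density)
      also have "\<dots> = (\<integral>x. (1 / c) *\<^sub>R (w x *\<^sub>R iexp (s * f x)) \<partial>M)"
        by (simp add: scaleR_conv_of_real)
      also have "\<dots> = (\<integral>x. (1 / c) *\<^sub>R (w x *\<^sub>R iexp (s * f x)) \<partial>N)"
        using ch[of s] by (simp only: integral_scaleR_right)
      also have "\<dots> = (\<integral>x. (w x / c) *\<^sub>R iexp (s * f x) \<partial>N)"
        by (simp add: scaleR_conv_of_real)
      also have "\<dots> = char DN s"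
        using w_nonneg c unfolding DN_def char_def
        by (subst integral_distr) (auto simp: integral_density)
      finally show ?thesis .
    qed
    then have "DM = DN"
      unfolding DM_def DN_def using c'
      by (intro Levy_uniqueness prob_space.real_distribution_distr *) (auto simp: c_def)
    then have eq: "(\<integral>y. indicator A y \<partial>DM) = (\<integral>y. indicator A y \<partial>DN :: real)"
      by simp
    have "(\<integral>x. (w x / c) * indicator A (f x) \<partial>M) = (\<integral>x. (w x / c) * indicator A (f x) \<partial>N)"
      using eq w_nonneg c unfolding DM_def DN_def
      by (subst (asm) (1 2) integral_distr) (auto simp: integral_density)
    then show ?thesis
      using c by simp
  qed
qed

lemma cos_sin_eq_iexp:
  "complex_of_real (cos x) = (iexp x + iexp (- x)) / 2"
  "complex_of_real (sin x) = (iexp x - iexp (- x)) / (2 * \<i>)"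
  by (simp_all add: cos_exp_eq sin_exp_eq flip: cos_of_real sin_of_real)

text \<open>Boxes generate the Borel sets and are stable under intersection, so it suffices to match
  their measures. The integral in \<open>step\<close>, an indicator constraining the coordinates in
  \<open>J\<close> times an exponential of arbitrary frequency, interpolates between the hypothesis
  (\<open>J\<close> empty) and the measure of a box (\<open>J = Basis\<close>, frequency 0).\<close>

theorem Levy_uniqueness_euclidean:
  fixes M N :: "'a::euclidean_space measure"
  assumes "prob_space M" "prob_space N" and sets_M: "sets M = sets borel" and sets_N: "sets N = sets borel"
    and ch: "\<And>t. (\<integral>x. iexp (t \<bullet> x) \<partial>M) = (\<integral>x. iexp (t \<bullet> x) \<partial>N)"
  shows "M = N"
proof -
  interpret M: prob_space M by fact
  interpret N: prob_space N by fact
  have meas [simp]: "borel_measurable M = borel_measurable borel" "borel_measurable N = borel_measurable borel"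
    "space M = UNIV" "space N = UNIV"
    using sets_eq_imp_space_eq[OF sets_M] sets_eq_imp_space_eq[OF sets_N]
    by (simp_all add: measurable_cong_sets[OF sets_M refl] measurable_cong_sets[OF sets_N refl])
  have eq_box: "measure M (box a b) = measure N (box a b)" for a b
  proof -
    define A where "A J = {x::'a. \<forall>j\<in>J. a \<bullet> j < x \<bullet> j \<and> x \<bullet> j < b \<bullet> j}" for J
    have A_meas [measurable]: "A J \<in> sets borel" if "finite J" for J
    proof -
      have "A J = {x\<in>space borel. \<forall>j\<in>J. a \<bullet> j < x \<bullet> j \<and> x \<bullet> j < b \<bullet> j}"
        by (simp add: A_def)
      also have "\<dots> \<in> sets borel"
        using that by measurable
      finally show ?thesis .
    qed
    have bnd: "integrable M (\<lambda>x. g x)" "integrable N (\<lambda>x. g x)"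
      if "g \<in> borel_measurable borel" "\<And>x. norm (g x) \<le> 1" for g :: "'a \<Rightarrow> complex"
      using that by (auto intro!: M.integrable_const_bound[of _ 1] N.integrable_const_bound[of _ 1])
    text \<open>Exponentials are exchanged for indicators one coordinate at a time; the weights
      \<open>1 + cos\<close> and \<open>1 + sin\<close> are nonnegative, so that the one-dimensional theorem applies.\<close>
    have step: "finite J \<Longrightarrow>
      (\<integral>x. indicator (A J) x *\<^sub>R iexp (t \<bullet> x) \<partial>M) = (\<integral>x. indicator (A J) x *\<^sub>R iexp (t \<bullet> x) \<partial>N)" for J t
    proof (induction J arbitrary: t rule: finite_induct)
      case empty
      then show ?case using ch[of t] by (simp add: A_def)
    next
      case (insert k J)
      note [measurable] = A_meas[OF \<open>finite J\<close>]
      define W where "W c t x = indicator (A J) x * (1 + c (t \<bullet> x))" for c :: "real \<Rightarrow> real" and t x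
      have ints: "integrable M (\<lambda>x. indicator (A J) x *\<^sub>R iexp (t \<bullet> x))"
        "integrable N (\<lambda>x. indicator (A J) x *\<^sub>R iexp (t \<bullet> x))" for t
        by (rule bnd; simp add: indicator_def)+
      define e where "e u x = indicator (A J) x *\<^sub>R iexp (u \<bullet> x)" for u x
      \<comment> \<open>\<open>c\<close> will be 0, cos or sin, each a combination of
        \<open>iexp y\<close> and \<open>iexp (- y)\<close>. A further exponential in direction
        \<open>k\<close> merely shifts the frequencies to \<open>s *\<^sub>R k\<close> and
        \<open>\<plusminus> t + s *\<^sub>R k\<close>, and the induction hypothesis holds for all
        frequencies.\<close>
      have W_ch: "(\<integral>x. W c t x *\<^sub>R iexp (s * (x \<bullet> k)) \<partial>M) = (\<integral>x. W c t x *\<^sub>R iexp (s * (x \<bullet> k)) \<partial>N)"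
        if c: "\<And>y. complex_of_real (c y) = \<alpha> * iexp y + \<beta> * iexp (- y)" for c s t \<alpha> \<beta>
      proof -
        have "W c t x *\<^sub>R iexp (s * (x \<bullet> k)) = indicator (A J) x *\<^sub>R iexp ((s *\<^sub>R k) \<bullet> x) +
            \<alpha> * (indicator (A J) x *\<^sub>R iexp ((t + s *\<^sub>R k) \<bullet> x)) +
            \<beta> * (indicator (A J) x *\<^sub>R iexp ((- t + s *\<^sub>R k) \<bullet> x))" for x
        proof -
          have "iexp ((t + s *\<^sub>R k) \<bullet> x) = iexp (t \<bullet> x) * iexp (s * (x \<bullet> k))"
            "iexp ((- t + s *\<^sub>R k) \<bullet> x) = iexp (- (t \<bullet> x)) * iexp (s * (x \<bullet> k))"
            unfolding exp_add[symmetric] by (simp_all add: inner_add_left inner_commute algebra_simps)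
          moreover have "iexp ((s *\<^sub>R k) \<bullet> x) = iexp (s * (x \<bullet> k))"
            by (simp add: inner_commute)
          ultimately show ?thesis
            unfolding W_def scaleR_conv_of_real of_real_mult of_real_add c
            by (simp add: algebra_simps)
        qed
        moreover have "integrable M (e u)" "integrable N (e u)" "(\<integral>x. e u x \<partial>M) = (\<integral>x. e u x \<partial>N)" for u
          unfolding e_def by (rule ints insert.IH)+
        ultimately show ?thesis
          unfolding e_def[symmetric] by simp
      qed
      have key: "(\<integral>x. W c t x * indicator {a \<bullet> k<..<b \<bullet> k} (x \<bullet> k) \<partial>M) =
          (\<integral>x. W c t x * indicator {a \<bullet> k<..<b \<bullet> k} (x \<bullet> k) \<partial>N)"
        if [measurable]: "c \<in> borel_measurable borel" and "\<And>y. \<bar>c y\<bar> \<le> 1"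
          and c: "\<And>y. complex_of_real (c y) = \<alpha> * iexp y + \<beta> * iexp (- y)" for c t \<alpha> \<beta>
      proof (rule weighted_Levy_uniqueness[where C=2])
        show "0 \<le> W c t x" "W c t x \<le> 2" for x
          using that(2)[of "t \<bullet> x"] by (auto simp: W_def indicator_def abs_le_iff)
        show "W c t \<in> borel_measurable M"
          unfolding W_def meas by measurable
      qed (use W_ch[OF c] assms in \<open>simp_all add: sets_M sets_N\<close>)
      have A_ins: "indicator (A (insert k J)) x = indicator (A J) x * (indicator {a \<bullet> k<..<b \<bullet> k} (x \<bullet> k) :: real)" for x
        by (auto simp: A_def indicator_def)
      have ri: "integrable M (\<lambda>x. indicator (A (insert k J)) x * c (t \<bullet> x))"
          "integrable N (\<lambda>x. indicator (A (insert k J)) x * c (t \<bullet> x))"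
        if [measurable]: "c \<in> borel_measurable borel" and "\<And>y. \<bar>c y\<bar> \<le> 1" for c :: "real \<Rightarrow> real" and t
        using that A_meas[of "insert k J"] insert.hyps
        by (auto intro!: M.integrable_const_bound[of _ 1] N.integrable_const_bound[of _ 1] simp: indicator_def)
      \<comment> \<open>The choice \<open>c = 0\<close> leaves the bare indicator; it serves to
        subtract the 1 that was added for the sake of nonnegativity.\<close>
      have one: "(\<integral>x. indicator (A (insert k J)) x * (1::real) \<partial>M) = (\<integral>x. indicator (A (insert k J)) x * 1 \<partial>N)"
        using key[of "\<lambda>_. 0" 0 0] by (simp add: W_def A_ins)
      have real_eq: "(\<integral>x. indicator (A (insert k J)) x * c (t \<bullet> x) \<partial>M) =
          (\<integral>x. indicator (A (insert k J)) x * c (t \<bullet> x) \<partial>N)"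
        if m: "c \<in> borel_measurable borel" and b: "\<And>y. \<bar>c y\<bar> \<le> 1"
          and c: "\<And>y. complex_of_real (c y) = \<alpha> * iexp y + \<beta> * iexp (- y)" for c t \<alpha> \<beta>
      proof -
        have "W c t x * indicator {a \<bullet> k<..<b \<bullet> k} (x \<bullet> k) =
           indicator (A (insert k J)) x * 1 + indicator (A (insert k J)) x * c (t \<bullet> x)" for x
          by (simp add: W_def A_ins algebra_simps)
        then have "(\<integral>x. indicator (A (insert k J)) x * (1::real) \<partial>M) + (\<integral>x. indicator (A (insert k J)) x * c (t \<bullet> x) \<partial>M)
           = (\<integral>x. indicator (A (insert k J)) x * (1::real) \<partial>N) + (\<integral>x. indicator (A (insert k J)) x * c (t \<bullet> x) \<partial>N)"
          using key[OF that, of t] ri[OF m b, of t] ri[of "\<lambda>_. 1" t] by simp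
        with one show ?thesis by simp
      qed
      have "indicator (A (insert k J)) x *\<^sub>R iexp (t \<bullet> x) =
          complex_of_real (indicator (A (insert k J)) x * cos (t \<bullet> x)) + \<i> * complex_of_real (indicator (A (insert k J)) x * sin (t \<bullet> x))" for x
        by (simp add: cis_conv_exp[symmetric] complex_eq_iff)
      moreover have "(\<integral>x. indicator (A (insert k J)) x * cos (t \<bullet> x) \<partial>M) = (\<integral>x. indicator (A (insert k J)) x * cos (t \<bullet> x) \<partial>N)"
        by (rule real_eq[of _ "1/2" "1/2"]) (auto simp: cos_sin_eq_iexp add_divide_distrib)
      moreover have "(\<integral>x. indicator (A (insert k J)) x * sin (t \<bullet> x) \<partial>M) = (\<integral>x. indicator (A (insert k J)) x * sin (t \<bullet> x) \<partial>N)"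
        by (rule real_eq[of _ "1/(2*\<i>)" "- 1/(2*\<i>)"]) (auto simp: cos_sin_eq_iexp field_simps)
      ultimately show ?case
        using ri[of cos t] ri[of sin t] by (simp del: of_real_mult)
    qed
    have "A Basis = box a b"
      by (auto simp: A_def box_def)
    with step[OF finite_Basis, of 0] A_meas[OF finite_Basis] show ?thesis
      by (simp add: scaleR_conv_of_real sets_M sets_N)
  qed
  show "M = N"
  proof (rule measure_eqI_generator_eq)
    show "Int_stable (range (\<lambda>(a, b). box a b :: 'a set))"
      by (auto simp: Int_stable_def box_Int_box)
    show "range (\<lambda>(a, b). box a b :: 'a set) \<subseteq> Pow UNIV"
      by simp
    show "emeasure M X = emeasure N X" if "X \<in> range (\<lambda>(a, b). box a b)" for X
      using that eq_box by (auto simp: M.emeasure_eq_measure N.emeasure_eq_measure)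
    show "sets M = sigma_sets UNIV (range (\<lambda>(a, b). box a b))" "sets N = sigma_sets UNIV (range (\<lambda>(a, b). box a b))"
      by (simp_all add: sets_M sets_N borel_eq_box)
    show "range (\<lambda>n::nat. box (- (real n *\<^sub>R One)) (real n *\<^sub>R One) :: 'a set) \<subseteq> range (\<lambda>(a, b). box a b)"
      by auto
    show "(\<Union>n::nat. box (- (real n *\<^sub>R One)) (real n *\<^sub>R One)) = (UNIV :: 'a set)"
      using UN_box_eq_UNIV by simp
  qed (simp add: M.emeasure_eq_measure)
qed

section \<open>Conditional distributions\<close>

text \<open>Kac's criterion for independence: by Fubini the product law has the product of the two
  characteristic functions, and uniqueness on the product space identifies it with the joint
  law.\<close>

lemma joint_law_eq_pair_measureI:
  fixes X :: "'w \<Rightarrow> 'a::euclidean_space" and Z :: "'w \<Rightarrow> 'b::euclidean_space"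
  assumes "prob_space M" and [measurable]: "X \<in> borel_measurable M" "Z \<in> borel_measurable M"
    and ch: "\<And>s t. (\<integral>\<omega>. iexp (s \<bullet> X \<omega> + t \<bullet> Z \<omega>) \<partial>M) = (\<integral>\<omega>. iexp (s \<bullet> X \<omega>) \<partial>M) * (\<integral>\<omega>. iexp (t \<bullet> Z \<omega>) \<partial>M)"
  shows "distr M borel (\<lambda>\<omega>. (X \<omega>, Z \<omega>)) = distr M borel X \<Otimes>\<^sub>M distr M borel Z"
proof -
  interpret prob_space M by fact
  interpret X: prob_space "distr M borel X" by (rule prob_space_distr) simp
  interpret Z: prob_space "distr M borel Z" by (rule prob_space_distr) simp
  interpret XZ: pair_prob_space "distr M borel X" "distr M borel Z" ..
  have sets: "sets (distr M borel X \<Otimes>\<^sub>M distr M borel Z) = sets borel"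
    unfolding borel_prod[symmetric] by (rule sets_pair_measure_cong) simp_all
  show ?thesis
  proof (rule Levy_uniqueness_euclidean)
    show "prob_space (distr M borel (\<lambda>\<omega>. (X \<omega>, Z \<omega>)))"
      by (rule prob_space_distr) simp
    show "prob_space (distr M borel X \<Otimes>\<^sub>M distr M borel Z)"
      by (rule XZ.prob_space_axioms)
    fix u :: "'a \<times> 'b"
    obtain s t where u: "u = (s, t)" by (cases u)
    have int: "integrable (distr M borel X \<Otimes>\<^sub>M distr M borel Z) (\<lambda>(x, z). iexp (s \<bullet> x) * iexp (t \<bullet> z))"
      by (rule XZ.integrable_const_bound[of _ 1]) (auto simp: norm_mult)
    have "(\<integral>p. iexp (u \<bullet> p) \<partial>(distr M borel X \<Otimes>\<^sub>M distr M borel Z)) =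
        (\<integral>p. (case p of (x, z) \<Rightarrow> iexp (s \<bullet> x) * iexp (t \<bullet> z)) \<partial>(distr M borel X \<Otimes>\<^sub>M distr M borel Z))"
      by (intro Bochner_Integration.integral_cong)
         (auto simp: u exp_add[symmetric] algebra_simps)
    also have "\<dots> = (\<integral>x. \<integral>z. iexp (s \<bullet> x) * iexp (t \<bullet> z) \<partial>distr M borel Z \<partial>distr M borel X)"
      using XZ.integral_fst'[OF int] by simp
    also have "\<dots> = (\<integral>x. iexp (s \<bullet> x) \<partial>distr M borel X) * (\<integral>z. iexp (t \<bullet> z) \<partial>distr M borel Z)"
      by simp
    also have "\<dots> = (\<integral>\<omega>. iexp (s \<bullet> X \<omega>) \<partial>M) * (\<integral>\<omega>. iexp (t \<bullet> Z \<omega>) \<partial>M)"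
      by (simp add: integral_distr)
    also have "\<dots> = (\<integral>\<omega>. iexp (s \<bullet> X \<omega> + t \<bullet> Z \<omega>) \<partial>M)"
      by (rule ch[symmetric])
    also have "\<dots> = (\<integral>p. iexp (u \<bullet> p) \<partial>distr M borel (\<lambda>\<omega>. (X \<omega>, Z \<omega>)))"
      by (simp add: integral_distr u)
    finally show "(\<integral>p. iexp (u \<bullet> p) \<partial>distr M borel (\<lambda>\<omega>. (X \<omega>, Z \<omega>))) =
        (\<integral>p. iexp (u \<bullet> p) \<partial>(distr M borel X \<Otimes>\<^sub>M distr M borel Z))" ..
  qed (rule sets_distr, rule sets)
qed

text \<open>Fixing \<open>X\<close> at \<open>y\<close> leaves the law of the independent
  \<open>Z\<close> unchanged and makes the shift \<open>h y\<close> a constant.\<close>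

lemma regular_conditional_distribution_shift:
  fixes X :: "'w \<Rightarrow> 'a::euclidean_space" and Z :: "'w \<Rightarrow> 'b::euclidean_space"
  assumes "prob_space M" and [measurable]: "X \<in> borel_measurable M" "Z \<in> borel_measurable M"
    and h [measurable]: "h \<in> borel_measurable borel"
    and indep: "distr M borel (\<lambda>\<omega>. (X \<omega>, Z \<omega>)) = distr M borel X \<Otimes>\<^sub>M distr M borel Z"
  shows "regular_conditional_distribution M X (\<lambda>\<omega>. Z \<omega> + h (X \<omega>))
    (\<lambda>y. distr (distr M borel Z) borel (\<lambda>z. z + h y))"
  unfolding regular_conditional_distribution_def
proof (intro conjI ballI)
  interpret prob_space M by fact
  interpret Z: prob_space "distr M borel Z" by (rule prob_space_distr) simp
  have "distr M borel Z \<in> space (prob_algebra borel)"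
    by (simp add: space_prob_algebra Z.prob_space_axioms)
  then show "(\<lambda>y. distr (distr M borel Z) borel (\<lambda>z. z + h y)) \<in> borel \<rightarrow>\<^sub>M prob_algebra borel"
    by (intro measurable_distr_prob_space2[where M=borel]) simp_all
  fix A :: "'a set" and B :: "'b set" assume [measurable]: "A \<in> sets borel" "B \<in> sets borel"
  \<comment> \<open>The event in terms of the independent pair: its section at \<open>y\<close> is
    empty outside \<open>A\<close> and a translate of \<open>B\<close> for \<open>y\<close> in
    \<open>A\<close>, so Fubini yields the defining identity.\<close>
  define Q where "Q = {p \<in> space (borel \<Otimes>\<^sub>M borel). fst p \<in> A \<and> snd p + h (fst p) \<in> B}"
  have Q [measurable]: "Q \<in> sets (borel \<Otimes>\<^sub>M borel)"
    unfolding Q_def by measurable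
  have "emeasure M {\<omega> \<in> space M. X \<omega> \<in> A \<and> Z \<omega> + h (X \<omega>) \<in> B} =
      emeasure M ((\<lambda>\<omega>. (X \<omega>, Z \<omega>)) -` Q \<inter> space M)"
    by (rule arg_cong[where f = "emeasure M"]) (auto simp: Q_def space_pair_measure)
  also have "\<dots> = emeasure (distr M borel (\<lambda>\<omega>. (X \<omega>, Z \<omega>))) Q"
    using Q[unfolded borel_prod] by (intro emeasure_distr[symmetric]) simp_all
  also have "\<dots> = (\<integral>\<^sup>+y. emeasure (distr M borel Z) (Pair y -` Q) \<partial>distr M borel X)"
    unfolding indep using Q by (intro Z.emeasure_pair_measure_alt) simp
  also have "\<dots> = (\<integral>\<^sup>+y\<in>A. emeasure (distr (distr M borel Z) borel (\<lambda>z. z + h y)) B \<partial>distr M borel X)"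
  proof (intro nn_integral_cong)
    fix y
    have "Pair y -` Q = (if y \<in> A then (\<lambda>z. z + h y) -` B else {})"
      by (auto simp: Q_def space_pair_measure)
    then show "emeasure (distr M borel Z) (Pair y -` Q) =
        emeasure (distr (distr M borel Z) borel (\<lambda>z. z + h y)) B * indicator A y"
      by (simp add: emeasure_distr[of "\<lambda>z. z + h y" "distr M borel Z" borel B])
  qed
  finally show "emeasure M {\<omega> \<in> space M. X \<omega> \<in> A \<and> Z \<omega> + h (X \<omega>) \<in> B} =
      (\<integral>\<^sup>+y\<in>A. emeasure (distr (distr M borel Z) borel (\<lambda>z. z + h y)) B \<partial>distr M borel X)" .
qed

text \<open>The defining identity fixes \<open>emeasure (\<kappa> y) B\<close> only up to a null set
  that depends on \<open>B\<close>. A countable generator stable under intersections reduces this to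
  a single null set.\<close>

lemma regular_conditional_distribution_AE_unique:
  fixes X :: "'w \<Rightarrow> 'a::topological_space" and Y :: "'w \<Rightarrow> 'b::second_countable_topology"
  assumes "prob_space M" and X: "X \<in> borel_measurable M"
    and \<kappa>: "regular_conditional_distribution M X Y \<kappa>" and \<kappa>': "regular_conditional_distribution M X Y \<kappa>'"
  shows "AE y in distr M borel X. \<kappa> y = \<kappa>' y"
proof -
  interpret prob_space M by fact
  interpret D: prob_space "distr M borel X" by (rule prob_space_distr) (rule X)
  have meas: "(\<lambda>y. emeasure (\<kappa> y) B) \<in> borel_measurable borel" "(\<lambda>y. emeasure (\<kappa>' y) B) \<in> borel_measurable borel"
    if "B \<in> sets borel" for B
    using \<kappa> \<kappa>' that unfolding regular_conditional_distribution_def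
    by (auto intro!: measurable_compose[OF measurable_prob_algebraD measurable_emeasure_subprob_algebra])
  have prob: "prob_space (\<kappa> y)" "sets (\<kappa> y) = sets borel" "prob_space (\<kappa>' y)" "sets (\<kappa>' y) = sets borel" for y
    using \<kappa> \<kappa>' unfolding regular_conditional_distribution_def
    by (auto dest!: measurable_space[of _ _ _ y] simp: space_prob_algebra)
  obtain E :: "'b set set" where E: "countable E" "topological_basis E"
    using ex_countable_basis by blast
  \<comment> \<open>Closing the countable basis under finite intersections keeps it countable and
    makes it intersection-stable; the empty intersection supplies \<open>UNIV\<close>.\<close>
  define E' where "E' = {\<Inter>F | F. F \<subseteq> E \<and> finite F}"
  have open_E': "open B" if "B \<in> E'" for B
    using that E topological_basis_open[of E] by (auto simp: E'_def intro!: open_Inter)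
  have "E' = Inter ` {F. finite F \<and> F \<subseteq> E}"
    by (auto simp: E'_def)
  then have "countable E'"
    using countable_Collect_finite_subset[OF E(1)] by simp
  have "E \<subseteq> E'"
    by (auto simp: E'_def intro!: exI[of _ "{_}"])
  then have sigma: "sets borel = sigma_sets UNIV E'"
  proof -
    have "topological_basis E'"
      using E(2) open_E' \<open>E \<subseteq> E'\<close> unfolding topological_basis_def by (meson subset_trans)
    from borel_eq_countable_basis[OF \<open>countable E'\<close> this]
    have "sets borel = sets (sigma UNIV E')" by (rule arg_cong)
    then show ?thesis by simp
  qed
  have "AE y in distr M borel X. emeasure (\<kappa> y) B = emeasure (\<kappa>' y) B" if "B \<in> E'" for B
  proof -
    have B: "B \<in> sets borel"
      using open_E'[OF that] by simp
    show ?thesis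
    \<comment> \<open>Both functions of \<open>y\<close> are densities of the same finite measure
      with respect to the law of \<open>X\<close>.\<close>
    proof (rule D.density_unique_finite_measure)
      show "(\<integral>\<^sup>+y. emeasure (\<kappa> y) B * indicator A y \<partial>distr M borel X) =
        (\<integral>\<^sup>+y. emeasure (\<kappa>' y) B * indicator A y \<partial>distr M borel X)" if "A \<in> sets (distr M borel X)" for A
      proof -
        have A: "A \<in> sets borel" using that by simp
        show ?thesis
          using \<kappa>[unfolded regular_conditional_distribution_def, THEN conjunct2, rule_format, OF A B]
            \<kappa>'[unfolded regular_conditional_distribution_def, THEN conjunct2, rule_format, OF A B]
          by simp
      qed
    qed (use meas[OF B] in simp_all)
  qed
  then have "AE y in distr M borel X. \<forall>B\<in>E'. emeasure (\<kappa> y) B = emeasure (\<kappa>' y) B"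
    using \<open>countable E'\<close> by (simp add: AE_ball_countable)
  then show ?thesis
  proof eventually_elim
    case (elim y)
    show ?case
    proof (rule measure_eqI_generator_eq)
      have "\<Inter>F \<inter> \<Inter>F' \<in> E'" if "F \<subseteq> E \<and> finite F" "F' \<subseteq> E \<and> finite F'" for F F'
        unfolding E'_def Inter_Un_distrib[symmetric] using that by blast
      then show "Int_stable E'"
        by (auto simp: Int_stable_def E'_def)
      have "\<Inter>{} \<in> E'"
        unfolding E'_def by blast
      then show "range (\<lambda>_::nat. UNIV) \<subseteq> E'"
        by simp
      show "emeasure (\<kappa> y) UNIV \<noteq> \<infinity>"
        using prob_space.finite_measure[OF prob(1)] by (simp add: finite_measure.emeasure_finite)
    qed (use elim prob sigma in auto)
  qed
qed

section \<open>The limit of the linear gradient flow\<close>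

text \<open>The quadratic form attains its minimum on the compact unit sphere. That minimum is
  positive and serves as \<open>c\<close>; homogeneity extends the bound to all vectors.\<close>

lemma positive_definite_coercive:
  fixes A :: "real^'m^'m"
  assumes "positive_definite A"
  obtains c where "0 < c" "\<And>v. c * (v \<bullet> v) \<le> v \<bullet> (A *v v)"
proof -
  have "continuous_on (sphere 0 1) (\<lambda>v::real^'m. v \<bullet> (A *v v))"
    by (intro continuous_intros linear_continuous_on_compose[OF continuous_on_id matrix_vector_mul_linear])
  then obtain w :: "real^'m" where w: "w \<in> sphere 0 1"
    and min: "\<And>v. v \<in> sphere 0 1 \<Longrightarrow> w \<bullet> (A *v w) \<le> v \<bullet> (A *v v)"
    using continuous_attains_inf[of "sphere (0::real^'m) 1" "\<lambda>v. v \<bullet> (A *v v)"] by auto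
  have "(w \<bullet> (A *v w)) * (v \<bullet> v) \<le> v \<bullet> (A *v v)" for v :: "real^'m"
  proof (cases "v = 0")
    case False
    define u where "u = (1 / norm v) *\<^sub>R v"
    have "u \<in> sphere 0 1" and v: "v = norm v *\<^sub>R u"
      using False by (simp_all add: u_def)
    have "v \<bullet> (A *v v) = (v \<bullet> v) * (u \<bullet> (A *v u))"
      by (subst (1 2) v) (simp add: matrix_vector_mult_scaleR power2_eq_square flip: power2_norm_eq_inner)
    then show ?thesis
      using min[OF \<open>u \<in> sphere 0 1\<close>] by (simp add: mult.commute mult_left_mono)
  qed simp
  moreover have "0 < w \<bullet> (A *v w)"
    using assms w unfolding positive_definite_def by (metis dist_0_norm mem_sphere norm_zero zero_neq_one)
  ultimately show thesis
    using that by blast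
qed

lemma positive_definite_invertible:
  fixes A :: "real^'m^'m"
  assumes "positive_definite A"
  shows "invertible A"
proof -
  have "x = 0" if "A *v x = 0" for x
    using assms that unfolding positive_definite_def by (metis inner_zero_right less_irrefl)
  then show ?thesis
    by (simp add: invertible_left_inverse matrix_left_invertible_ker)
qed

lemma matrix_inv_mult:
  fixes A :: "real^'m^'m"
  assumes "invertible A"
  shows "matrix_inv A ** A = mat 1" "A ** matrix_inv A = mat 1"
  using someI_ex[OF assms[unfolded invertible_def]] by (simp_all add: matrix_inv_def)

text \<open>Lyapunov argument: the squared training residual \<open>V\<close> satisfies V' = -2 e
  \<bullet> (A e) \<le> -2 c V, where A is the kernel matrix and \<open>c\<close> its coercivity
  constant, so it decays exponentially.\<close>

lemma ntk_gradient_flow_residual_tendsto_0: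
  fixes X :: "'m::finite \<Rightarrow> 'x"
  assumes pd: "positive_definite (kernel_matrix \<Theta> X X)" and flow: "ntk_gradient_flow \<Theta> X y f"
  shows "((\<lambda>t. f t (X j) - y j) \<longlongrightarrow> 0) at_top"
proof -
  define e where "e t = (\<chi> j. f t (X j) - y j)" for t
  define V where "V t = (\<Sum>j\<in>UNIV. (f t (X j) - y j)\<^sup>2)" for t
  obtain c where "0 < c" and c: "\<And>v. c * (v \<bullet> v) \<le> v \<bullet> (kernel_matrix \<Theta> X X *v v)"
    using positive_definite_coercive[OF pd] by blast
  have V_eq: "V t = e t \<bullet> e t" for t
    by (simp add: V_def e_def inner_vec_def power2_eq_square)
  have dV: "(V has_real_derivative - 2 * (e t \<bullet> (kernel_matrix \<Theta> X X *v e t))) (at t within {0..})" if "0 \<le> t" for t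
  proof -
    have "((\<lambda>s. f s (X j)) has_real_derivative - (\<Sum>i\<in>UNIV. \<Theta> (X j) (X i) * (f t (X i) - y i))) (at t within {0..})" for j
      using flow that unfolding ntk_gradient_flow_def by blast
    note df = this
    have "((\<lambda>s. (f s (X j) - y j)\<^sup>2) has_real_derivative 2 * (f t (X j) - y j) *
        - (\<Sum>i\<in>UNIV. \<Theta> (X j) (X i) * (f t (X i) - y i))) (at t within {0..})" for j
      using DERIV_power[OF DERIV_diff[OF df[of j] DERIV_const[where k = "y j"]], where n = 2] by (simp add: algebra_simps)
    then have "(V has_real_derivative (\<Sum>j\<in>UNIV. 2 * (f t (X j) - y j) *
        - (\<Sum>i\<in>UNIV. \<Theta> (X j) (X i) * (f t (X i) - y i)))) (at t within {0..})"
      unfolding V_def by (rule DERIV_sum)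
    moreover have "(\<Sum>j\<in>UNIV. 2 * (f t (X j) - y j) * - (\<Sum>i\<in>UNIV. \<Theta> (X j) (X i) * (f t (X i) - y i))) =
        - 2 * (e t \<bullet> (kernel_matrix \<Theta> X X *v e t))"
    proof -
      have "f t (X j) - y j = e t $ j" for j
        by (simp add: e_def)
      then show ?thesis
        by (simp add: inner_vec_def matrix_vector_mult_def kernel_matrix_def sum_distrib_left sum_negf mult_ac)
    qed
    ultimately show ?thesis by simp
  qed
  have bound: "V t \<le> V 0 * exp (- 2 * c * t)" if "0 \<le> t" for t
  proof -
    \<comment> \<open>The integrating factor exp(2 c t) turns the differential inequality into
      monotonicity of a product, as in Gronwall's lemma.\<close>
    have d: "((\<lambda>t. V t * exp (2 * c * t)) has_real_derivative
        exp (2 * c * s) * (2 * (c * (e s \<bullet> e s) - e s \<bullet> (kernel_matrix \<Theta> X X *v e s)))) (at s within {0..})" if "0 \<le> s" for s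
    proof -
      have ring_eq: "- 2 * q * E + E * (2 * c) * v = E * (2 * (c * v - q))" for q E v :: real
        by (simp add: right_diff_distrib)
      have "((\<lambda>t. exp (2 * c * t)) has_real_derivative exp (2 * c * s) * (2 * c)) (at s within {0..})"
        by (rule has_field_derivative_at_within, rule DERIV_fun_exp[OF DERIV_cmult_Id])
      from DERIV_mult[OF dV[OF that] this]
      show ?thesis
        unfolding V_eq[symmetric] by (rule DERIV_cong) (rule ring_eq)
    qed
    have "V t * exp (2 * c * t) \<le> V 0 * exp (2 * c * 0)"
    proof (rule DERIV_nonpos_imp_decreasing_open[OF that])
      fix s assume s: "0 < s" "s < t"
      \<comment> \<open>The flow gives derivatives within \<open>{0..}\<close> only. They are
        two-sided at interior points, and continuity takes care of the endpoint 0.\<close>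
      then have at: "at s within {0..} = at s"
        by (intro at_within_interior) simp
      have "((\<lambda>t. V t * exp (2 * c * t)) has_real_derivative
        exp (2 * c * s) * (2 * (c * (e s \<bullet> e s) - e s \<bullet> (kernel_matrix \<Theta> X X *v e s)))) (at s)"
        using d[OF less_imp_le[OF s(1)]] unfolding at .
      moreover have "exp (2 * c * s) * (2 * (c * (e s \<bullet> e s) - e s \<bullet> (kernel_matrix \<Theta> X X *v e s))) \<le> 0"
        using c[of "e s"] by (simp add: mult_le_0_iff)
      ultimately show "\<exists>y. ((\<lambda>t. V t * exp (2 * c * t)) has_real_derivative y) (at s) \<and> y \<le> 0"
        by blast
    next
      have "continuous_on {0..} (\<lambda>t. V t * exp (2 * c * t))"
        using d by (intro DERIV_continuous_on) auto
      then show "continuous_on {0..t} (\<lambda>t. V t * exp (2 * c * t))"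
        by (rule continuous_on_subset) auto
    qed
    then have "V t * exp (2 * c * t) * exp (- 2 * c * t) \<le> V 0 * exp (- 2 * c * t)"
      by (simp add: mult_right_mono)
    then show ?thesis
      by (simp add: mult.assoc flip: exp_add)
  qed
  have lim: "((\<lambda>t. sqrt (V 0 * exp (- 2 * c * t))) \<longlongrightarrow> 0) at_top"
  proof -
    have "filterlim (\<lambda>t. - 2 * c * t) at_bot at_top"
      using \<open>0 < c\<close> by (intro filterlim_tendsto_neg_mult_at_bot[OF tendsto_const _ filterlim_ident]) simp
    then have "((\<lambda>t. exp (- 2 * c * t)) \<longlongrightarrow> 0) at_top"
      by (rule filterlim_compose[OF exp_at_bot])
    from tendsto_real_sqrt[OF tendsto_mult_right_zero[OF this, of "V 0"]] show ?thesis by simp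
  qed
  show ?thesis
  proof (rule tendsto_0_le[OF lim, where K = 1])
    have "\<bar>f t (X j) - y j\<bar> \<le> sqrt (V 0 * exp (- 2 * c * t))" if "0 \<le> t" for t
    proof (rule real_le_rsqrt)
      have "(f t (X j) - y j)\<^sup>2 \<le> V t"
        unfolding V_def by (rule member_le_sum) auto
      with bound[OF that] show "\<bar>f t (X j) - y j\<bar>\<^sup>2 \<le> V 0 * exp (- 2 * c * t)"
        by simp
    qed
    then show "\<forall>\<^sub>F t in at_top. norm (f t (X j) - y j) \<le> norm (sqrt (V 0 * exp (- 2 * c * t))) * 1"
      by (intro eventually_mono[OF eventually_ge_at_top[of 0]]) (use abs_ge_self order_trans in fastforce)
  qed
qed

text \<open>\<open>f t x - \<Theta>(x, X) \<Theta>(X, X)\<inverse> (f t X - y)\<close> is a conserved quantity of the flow.\<close>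

lemma ntk_gradient_flow_limit:
  fixes X :: "'m::finite \<Rightarrow> 'x"
  assumes pd: "positive_definite (kernel_matrix \<Theta> X X)" and flow: "ntk_gradient_flow \<Theta> X y f"
  shows "((\<lambda>t. f t x) \<longlongrightarrow> f 0 x -
      (\<Sum>j\<in>UNIV. \<Theta> x (X j) * (matrix_inv (kernel_matrix \<Theta> X X) *v (\<chi> j. f 0 (X j) - y j)) $ j)) at_top"
proof -
  define A where "A = kernel_matrix \<Theta> X X"
  define e where "e t = (\<chi> j. f t (X j) - y j)" for t
  define q where "q t = (\<Sum>j\<in>UNIV. \<Theta> x (X j) * (\<Sum>i\<in>UNIV. matrix_inv A $ j $ i * (f t (X i) - y i)))" for t
  have inv: "matrix_inv A ** A = mat 1"
    unfolding A_def by (rule matrix_inv_mult(1)[OF positive_definite_invertible[OF pd]])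
  have q_eq: "q t = (\<Sum>j\<in>UNIV. \<Theta> x (X j) * (matrix_inv A *v e t) $ j)" for t
    by (simp add: q_def e_def matrix_vector_mult_def)
  have "((\<lambda>t. f t x - q t) has_real_derivative 0) (at t within {0..})" if "0 \<le> t" for t
  proof -
    \<comment> \<open>The inverse cancels the kernel matrix in the derivative of the training
      residual, so that \<open>q\<close> changes at exactly the rate of
      \<open>f t x\<close>.\<close>
    have "(\<Sum>i\<in>UNIV. matrix_inv A $ j $ i * (\<Sum>k\<in>UNIV. \<Theta> (X i) (X k) * (f t (X k) - y k))) = f t (X j) - y j" for j
    proof -
      have "(\<Sum>i\<in>UNIV. matrix_inv A $ j $ i * (\<Sum>k\<in>UNIV. \<Theta> (X i) (X k) * (f t (X k) - y k))) =
          (matrix_inv A *v (A *v e t)) $ j"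
        by (simp add: matrix_vector_mult_def A_def kernel_matrix_def e_def)
      then show ?thesis
        by (simp add: matrix_vector_mul_assoc inv e_def)
    qed
    note h = this
    have *: "(\<Sum>j\<in>UNIV. \<Theta> x (X j) * (\<Sum>i\<in>UNIV. matrix_inv A $ j $ i *
        - (\<Sum>k\<in>UNIV. \<Theta> (X i) (X k) * (f t (X k) - y k)))) = - (\<Sum>j\<in>UNIV. \<Theta> x (X j) * (f t (X j) - y j))"
      by (simp only: mult_minus_right sum_negf h)
    have D: "((\<lambda>s. f s z) has_real_derivative - (\<Sum>j\<in>UNIV. \<Theta> z (X j) * (f t (X j) - y j))) (at t within {0..})" for z
      using flow that unfolding ntk_gradient_flow_def by blast
    have D': "((\<lambda>s. f s (X i) - y i) has_real_derivative - (\<Sum>j\<in>UNIV. \<Theta> (X i) (X j) * (f t (X j) - y j))) (at t within {0..})" for i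
      using DERIV_diff[OF D DERIV_const] by simp
    have "(q has_real_derivative (\<Sum>j\<in>UNIV. \<Theta> x (X j) * (\<Sum>i\<in>UNIV. matrix_inv A $ j $ i *
        - (\<Sum>k\<in>UNIV. \<Theta> (X i) (X k) * (f t (X k) - y k))))) (at t within {0..})"
      unfolding q_def by (intro DERIV_sum DERIV_cmult D')
    from DERIV_diff[OF D[of x] this] show ?thesis
      unfolding * by simp
  qed
  then obtain K where K: "\<And>t. 0 \<le> t \<Longrightarrow> f t x - q t = K"
    using has_field_derivative_zero_constant[of "{0::real..}" "\<lambda>t. f t x - q t"] by auto
  have "(q \<longlongrightarrow> (\<Sum>j\<in>UNIV. \<Theta> x (X j) * (\<Sum>i\<in>UNIV. matrix_inv A $ j $ i * 0))) at_top"
    unfolding q_def by (intro tendsto_intros ntk_gradient_flow_residual_tendsto_0[OF pd flow])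
  from tendsto_add[OF this tendsto_const[of K]]
  have "((\<lambda>t. q t + K) \<longlongrightarrow> K) at_top"
    by simp
  moreover have "\<forall>\<^sub>F t in at_top. q t + K = f t x"
    using eventually_ge_at_top[of 0] by eventually_elim (use K in force)
  ultimately have "((\<lambda>t. f t x) \<longlongrightarrow> K) at_top"
    by (rule Lim_transform_eventually)
  moreover have "K = f 0 x - q 0"
    using K[of 0] by simp
  ultimately show ?thesis
    by (simp add: q_eq A_def e_def)
qed

section \<open>Convergence in probability and measurability of derivatives\<close>

lemma tendsto_in_probI:
  assumes "\<And>e. 0 < e \<Longrightarrow> \<exists>p. (p \<longlonglongrightarrow> 0) \<and> (\<forall>n. measure (M n) {\<omega> \<in> space (M n). e < \<bar>X n \<omega> - c\<bar>} \<le> p n)"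
  shows "tendsto_in_prob M X c"
  unfolding tendsto_in_prob_def
proof (intro allI impI)
  fix e :: real assume "0 < e"
  from assms[OF this] obtain p where p: "p \<longlonglongrightarrow> 0"
    and le: "measure (M n) {\<omega> \<in> space (M n). e < \<bar>X n \<omega> - c\<bar>} \<le> p n" for n
    by blast
  show "(\<lambda>n. measure (M n) {\<omega> \<in> space (M n). e < \<bar>X n \<omega> - c\<bar>}) \<longlonglongrightarrow> 0"
    by (rule tendsto_sandwich[OF _ _ tendsto_const p]) (simp_all add: le)
qed

lemma tendsto_in_prob_add:
  assumes M: "\<And>n. prob_space (M n)"
    and [measurable]: "\<And>n. X n \<in> borel_measurable (M n)" "\<And>n. Y n \<in> borel_measurable (M n)"
    and X: "tendsto_in_prob M X c" and Y: "tendsto_in_prob M Y d"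
  shows "tendsto_in_prob M (\<lambda>n \<omega>. X n \<omega> + Y n \<omega>) (c + d)"
proof (rule tendsto_in_probI)
  fix e :: real assume e: "0 < e"
  let ?p = "\<lambda>n. measure (M n) {\<omega> \<in> space (M n). e / 2 < \<bar>X n \<omega> - c\<bar>} +
    measure (M n) {\<omega> \<in> space (M n). e / 2 < \<bar>Y n \<omega> - d\<bar>}"
  have "measure (M n) {\<omega> \<in> space (M n). e < \<bar>X n \<omega> + Y n \<omega> - (c + d)\<bar>} \<le> ?p n" for n
  proof -
    interpret prob_space "M n" by (rule M)
    have "prob {\<omega> \<in> space (M n). e < \<bar>X n \<omega> + Y n \<omega> - (c + d)\<bar>} \<le>
        prob ({\<omega> \<in> space (M n). e / 2 < \<bar>X n \<omega> - c\<bar>} \<union> {\<omega> \<in> space (M n). e / 2 < \<bar>Y n \<omega> - d\<bar>})"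
    proof (intro finite_measure_mono subsetI)
      fix \<omega> assume "\<omega> \<in> {\<omega> \<in> space (M n). e < \<bar>X n \<omega> + Y n \<omega> - (c + d)\<bar>}"
      moreover from this have "e / 2 < \<bar>X n \<omega> - c\<bar> \<or> e / 2 < \<bar>Y n \<omega> - d\<bar>"
        by (simp add: abs_if split: if_splits) linarith+
      ultimately show "\<omega> \<in> {\<omega> \<in> space (M n). e / 2 < \<bar>X n \<omega> - c\<bar>} \<union> {\<omega> \<in> space (M n). e / 2 < \<bar>Y n \<omega> - d\<bar>}"
        by blast
    qed measurable
    also have "\<dots> \<le> ?p n"
      by (intro measure_Un_le) auto
    finally show ?thesis .
  qed
  moreover have "?p \<longlonglongrightarrow> 0"
    using X Y e half_gt_zero[OF e] unfolding tendsto_in_prob_def by (intro tendsto_add_zero) blast+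
  ultimately show "\<exists>p. (p \<longlonglongrightarrow> 0) \<and> (\<forall>n. measure (M n) {\<omega> \<in> space (M n). e < \<bar>X n \<omega> + Y n \<omega> - (c + d)\<bar>} \<le> p n)"
    by (intro exI[of _ ?p] conjI allI)
qed

lemma tendsto_in_prob_const: "tendsto_in_prob M (\<lambda>n \<omega>. c) c"
  by (simp add: tendsto_in_prob_def)

lemma tendsto_in_prob_cmult:
  assumes "tendsto_in_prob M X c"
  shows "tendsto_in_prob M (\<lambda>n \<omega>. a * X n \<omega>) (a * c)"
proof (cases "a = 0")
  case False
  have "(e < \<bar>a * x - a * c\<bar>) = (e / \<bar>a\<bar> < \<bar>x - c\<bar>)" for e x
  proof -
    have "\<bar>a * x - a * c\<bar> = \<bar>x - c\<bar> * \<bar>a\<bar>"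
      by (metis abs_mult mult.commute right_diff_distrib)
    then show ?thesis
      using False by (simp add: pos_divide_less_eq)
  qed
  then show ?thesis
    using assms False by (simp add: tendsto_in_prob_def)
qed (simp add: tendsto_in_prob_const)

lemma tendsto_in_prob_sum:
  assumes M: "\<And>n. prob_space (M n)" and "finite J"
    and meas: "\<And>n j. j \<in> J \<Longrightarrow> X j n \<in> borel_measurable (M n)"
    and lim: "\<And>j. j \<in> J \<Longrightarrow> tendsto_in_prob M (X j) (c j)"
  shows "tendsto_in_prob M (\<lambda>n \<omega>. \<Sum>j\<in>J. X j n \<omega>) (\<Sum>j\<in>J. c j)"
  using assms(2) meas lim
proof (induction J rule: finite_induct)
  case (insert j J)
  have "tendsto_in_prob M (\<lambda>n \<omega>. X j n \<omega> + (\<Sum>j\<in>J. X j n \<omega>)) (c j + (\<Sum>j\<in>J. c j))"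
    using insert by (intro tendsto_in_prob_add[OF M]) (auto intro!: borel_measurable_sum)
  then show ?case
    using insert by simp
qed (simp add: tendsto_in_prob_const)

text \<open>On nonnegative arguments exp(-x/2) is bounded and Lipschitz, which upgrades convergence
  in probability to convergence in L1.\<close>

lemma tendsto_in_prob_exp_neg:
  assumes M: "\<And>n. prob_space (M n)" and [measurable]: "\<And>n. X n \<in> borel_measurable (M n)"
    and X: "tendsto_in_prob M X c" and "0 \<le> c" and nonneg: "\<And>n \<omega>. 0 \<le> X n \<omega>"
  shows "(\<lambda>n. \<integral>\<omega>. \<bar>exp (- X n \<omega> / 2) - exp (- c / 2)\<bar> \<partial>M n) \<longlonglongrightarrow> 0"
proof (rule LIMSEQ_I)
  fix r :: real assume r: "0 < r"
  have lip: "\<bar>exp (- x / 2) - exp (- c / 2)\<bar> \<le> \<bar>x - c\<bar>" if x: "0 \<le> x" for x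
  proof -
    have *: "exp (- a) - exp (- b) \<le> b - a" if "0 \<le> a" "a \<le> b" for a b :: real
    proof -
      have "1 - exp (- (b - a)) \<le> b - a"
        using exp_ge_add_one_self[of "- (b - a)"] by linarith
      then have "exp (- a) * (1 - exp (- (b - a))) \<le> 1 * (b - a)"
        using that by (intro mult_mono) auto
      then show ?thesis by (simp add: algebra_simps flip: exp_add)
    qed
    show ?thesis
      using *[of "x / 2" "c / 2"] *[of "c / 2" "x / 2"] x \<open>0 \<le> c\<close> by (cases "x \<le> c") auto
  qed
  \<comment> \<open>Outside the bad event the error is at most \<open>r / 2\<close>; on it the error
    is at most 2 and the probability below \<open>r / 4\<close>. Together this stays below
    \<open>r\<close>.\<close>
  have "(\<lambda>n. measure (M n) {\<omega> \<in> space (M n). r / 2 < \<bar>X n \<omega> - c\<bar>}) \<longlonglongrightarrow> 0"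
    using r by (intro X[unfolded tendsto_in_prob_def, rule_format]) simp
  from LIMSEQ_D[OF this, of "r / 4"] r obtain N
    where N: "\<And>n. N \<le> n \<Longrightarrow> measure (M n) {\<omega> \<in> space (M n). r / 2 < \<bar>X n \<omega> - c\<bar>} < r / 4"
    by auto
  have "norm ((\<integral>\<omega>. \<bar>exp (- X n \<omega> / 2) - exp (- c / 2)\<bar> \<partial>M n) - 0) < r" if "N \<le> n" for n
  proof -
    interpret prob_space "M n" by (rule M)
    let ?B = "{\<omega> \<in> space (M n). r / 2 < \<bar>X n \<omega> - c\<bar>}"
    have le2: "\<bar>exp (- x / 2) - exp (- c / 2)\<bar> \<le> 2" if "0 \<le> x" for x
    proof -
      have "0 < exp (- x / 2)" "exp (- x / 2) \<le> 1" "0 < exp (- c / 2)" "exp (- c / 2) \<le> 1"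
        using that \<open>0 \<le> c\<close> by simp_all
      then show ?thesis by linarith
    qed
    have pt: "\<bar>exp (- X n \<omega> / 2) - exp (- c / 2)\<bar> \<le> r / 2 + 2 * indicator ?B \<omega>" if "\<omega> \<in> space (M n)" for \<omega>
    proof (cases "\<omega> \<in> ?B")
      case True
      then show ?thesis using le2[OF nonneg[of n \<omega>]] r by simp
    next
      case False
      then show ?thesis using that lip[OF nonneg[of n \<omega>]] by (auto simp: indicator_def)
    qed
    have "(\<integral>\<omega>. \<bar>exp (- X n \<omega> / 2) - exp (- c / 2)\<bar> \<partial>M n) \<le> (\<integral>\<omega>. r / 2 + 2 * indicator ?B \<omega> \<partial>M n)"
    proof (rule integral_mono[OF _ _ pt])
      show "integrable (M n) (\<lambda>\<omega>. \<bar>exp (- X n \<omega> / 2) - exp (- c / 2)\<bar>)"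
        using le2[OF nonneg] by (intro integrable_const_bound[of _ 2] AE_I2) simp_all
      show "integrable (M n) (\<lambda>\<omega>. r / 2 + 2 * indicator ?B \<omega>)"
        by (intro Bochner_Integration.integrable_add integrable_mult_right) (auto simp: integrable_indicator_iff emeasure_eq_measure)
    qed
    also have "\<dots> = r / 2 + 2 * prob ?B"
      by (subst Bochner_Integration.integral_add) (auto simp: prob_space emeasure_eq_measure)
    also have "\<dots> < r"
      using N[OF that] by simp
    finally show ?thesis
      by simp
  qed
  then show "\<exists>N. \<forall>n\<ge>N. norm ((\<integral>\<omega>. \<bar>exp (- X n \<omega> / 2) - exp (- c / 2)\<bar> \<partial>M n) - 0) < r"
    by blast
qed

text \<open>Otherwise the deviation event would be the whole space for every \<open>n\<close>, of
  probability 1. Sample points near the limit let pointwise inequalities pass to the deterministic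
  limit.\<close>

lemma tendsto_in_prob_witness:
  assumes M: "\<And>n. prob_space (M n)" and "\<And>n. X n \<in> borel_measurable (M n)"
    "tendsto_in_prob M X c" "0 < e"
  shows "\<exists>n. \<exists>\<omega>\<in>space (M n). \<bar>X n \<omega> - c\<bar> \<le> e"
proof (rule ccontr)
  assume "\<not> ?thesis"
  then have *: "{\<omega> \<in> space (M n). e < \<bar>X n \<omega> - c\<bar>} = space (M n)" for n
    by (auto simp: not_le)
  have "(\<lambda>n. measure (M n) {\<omega> \<in> space (M n). e < \<bar>X n \<omega> - c\<bar>}) \<longlonglongrightarrow> 0"
    using assms(3,4) by (simp add: tendsto_in_prob_def)
  then show False
    unfolding * prob_space.prob_space[OF M] by (simp add: LIMSEQ_const_iff)
qed

lemma tendsto_in_prob_nonneg: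
  assumes "\<And>n. prob_space (M n)" "\<And>n. X n \<in> borel_measurable (M n)"
    "tendsto_in_prob M X c" and nonneg: "\<And>n \<omega>. 0 \<le> X n \<omega>"
  shows "0 \<le> c"
proof (rule ccontr)
  assume "\<not> 0 \<le> c"
  then obtain n \<omega> where "\<bar>X n \<omega> - c\<bar> \<le> - c / 2"
    using tendsto_in_prob_witness[OF assms(1-3), of "- c / 2"] by auto
  with nonneg[of n \<omega>] \<open>\<not> 0 \<le> c\<close> show False by linarith
qed

lemma tendsto_in_prob_unique:
  assumes M: "\<And>n. prob_space (M n)" and meas: "\<And>n. X n \<in> borel_measurable (M n)"
    and c: "tendsto_in_prob M X c" and d: "tendsto_in_prob M X d"
  shows "c = d"
proof -
  have "tendsto_in_prob M (\<lambda>n \<omega>. X n \<omega> + (- 1) * X n \<omega>) (c + (- 1) * d)"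
    using meas by (intro tendsto_in_prob_add[OF M] tendsto_in_prob_cmult c d) auto
  then have lim: "tendsto_in_prob M (\<lambda>n \<omega>. 0) (c - d)"
    by simp
  have "\<bar>c - d\<bar> \<le> e" if "0 < e" for e
    using tendsto_in_prob_witness[OF M _ lim that] by auto
  then show ?thesis
    using dense_ge[of 0 "\<bar>c - d\<bar>"] by auto
qed

text \<open>By continuity, rational increments decide differentiability at 0.\<close>

lemma borel_measurable_deriv:
  fixes F :: "'a \<Rightarrow> real \<Rightarrow> real"
  assumes [measurable]: "\<And>h. (\<lambda>\<omega>. F \<omega> h) \<in> borel_measurable M"
    and cont: "\<And>\<omega>. continuous_on UNIV (F \<omega>)"
  shows "(\<lambda>\<omega>. deriv (F \<omega>) 0) \<in> borel_measurable M"
proof -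
  \<comment> \<open>The only possible value of the derivative, taken along the increments 1/(n+1).
    Where \<open>lim\<close> has no meaning its value is arbitrary, and \<open>S\<close> decides
    whether it is the derivative.\<close>
  define D where "D \<omega> = lim (\<lambda>n. (F \<omega> (1 / real (Suc n)) - F \<omega> 0) * real (Suc n))" for \<omega>
  have [measurable]: "D \<in> borel_measurable M"
    unfolding D_def by measurable
  \<comment> \<open>Differentiability with derivative \<open>D \<omega>\<close>, multiplied through
    by the increment and with countable quantifiers only, so that the condition is
    measurable.\<close>
  define S where "S \<omega> \<longleftrightarrow> (\<forall>k. \<exists>m. \<forall>q::rat. \<bar>real_of_rat q\<bar> < 1 / real (Suc m) \<longrightarrow>
      \<bar>F \<omega> (real_of_rat q) - F \<omega> 0 - D \<omega> * real_of_rat q\<bar> \<le> \<bar>real_of_rat q\<bar> / real (Suc k))" for \<omega>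
  have [measurable]: "Measurable.pred M S"
  proof -
    have "Measurable.pred M (\<lambda>\<omega>. \<bar>h\<bar> < 1 / real (Suc m) \<longrightarrow>
      \<bar>F \<omega> h - F \<omega> 0 - D \<omega> * h\<bar> \<le> \<bar>h\<bar> / real (Suc k))" for h k m
      by measurable
    then show ?thesis
      unfolding S_def by (intro pred_intros_countable)
  qed
  have S: "(F \<omega> has_real_derivative D \<omega>) (at 0)" if "S \<omega>" for \<omega>
    unfolding DERIV_def LIM_eq
  proof (intro allI impI)
    fix r :: real assume "0 < r"
    then obtain k where k: "1 / real (Suc k) < r"
      using reals_Archimedean[of r] by (auto simp: inverse_eq_divide)
    from that obtain m where m: "\<And>h. h \<in> \<rat> \<Longrightarrow> \<bar>h\<bar> < 1 / real (Suc m) \<Longrightarrow>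
      \<bar>F \<omega> h - F \<omega> 0 - D \<omega> * h\<bar> \<le> \<bar>h\<bar> / real (Suc k)"
      unfolding S_def Rats_def by blast
    \<comment> \<open>By continuity the set of increments satisfying the estimate is closed; it
      contains the rational ones of a ball, hence the whole ball.\<close>
    define C where "C = {h. \<bar>F \<omega> h - F \<omega> 0 - D \<omega> * h\<bar> \<le> \<bar>h\<bar> / real (Suc k)}"
    have "closed C"
      unfolding C_def by (intro closed_Collect_le continuous_intros cont) simp_all
    have "ball (0::real) (1 / real (Suc m)) \<subseteq> closure (ball 0 (1 / real (Suc m)) \<inter> \<rat>)"
      using open_Int_closure_subset[OF open_ball, of "0::real" "1 / real (Suc m)" \<rat>] by (simp add: Rats_closure_real)
    also have "\<dots> \<subseteq> C"
      using m \<open>closed C\<close> by (intro closure_minimal) (auto simp: C_def)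
    finally have le: "\<bar>F \<omega> h - F \<omega> 0 - D \<omega> * h\<bar> \<le> \<bar>h\<bar> / real (Suc k)" if "\<bar>h\<bar> < 1 / real (Suc m)" for h
      using that by (auto simp: C_def subset_eq)
    show "\<exists>s>0. \<forall>x. x \<noteq> 0 \<and> norm (x - 0) < s \<longrightarrow> norm ((F \<omega> (0 + x) - F \<omega> 0) / x - D \<omega>) < r"
    proof (intro exI[of _ "1 / real (Suc m)"] conjI allI impI)
      fix x :: real assume x: "x \<noteq> 0 \<and> norm (x - 0) < 1 / real (Suc m)"
      have "(F \<omega> x - F \<omega> 0) / x - D \<omega> = (F \<omega> x - F \<omega> 0 - D \<omega> * x) / x"
        using x by (simp add: field_simps)
      moreover have "\<bar>(F \<omega> x - F \<omega> 0 - D \<omega> * x) / x\<bar> \<le> 1 / real (Suc k)"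
        using le[of x] x by (simp add: abs_divide field_simps)
      ultimately show "norm ((F \<omega> (0 + x) - F \<omega> 0) / x - D \<omega>) < r"
        using k by simp
    qed simp
  qed
  have D: "S \<omega>" if d: "(F \<omega> has_real_derivative d) (at 0)" for \<omega> d
  proof -
    have lim: "((\<lambda>h. (F \<omega> (0 + h) - F \<omega> 0) / h) \<longlongrightarrow> d) (at 0)"
      using d by (simp add: DERIV_def)
    have "filterlim (\<lambda>n. 1 / real (Suc n)) (at 0) sequentially"
      using lim_1_over_n[THEN LIMSEQ_Suc] by (intro filterlim_atI) auto
    from filterlim_compose[OF lim this]
    have "(\<lambda>n. (F \<omega> (1 / real (Suc n)) - F \<omega> 0) * real (Suc n)) \<longlonglongrightarrow> d"
      by simp
    then have "D \<omega> = d"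
      unfolding D_def by (rule limI)
    show "S \<omega>"
      unfolding S_def
    proof
      fix k
      from lim[unfolded LIM_eq, rule_format, of "1 / real (Suc k)"] obtain s where "0 < s"
        and s: "\<And>h. h \<noteq> 0 \<Longrightarrow> \<bar>h\<bar> < s \<Longrightarrow> \<bar>(F \<omega> h - F \<omega> 0) / h - d\<bar> < 1 / real (Suc k)"
        by auto
      obtain m where m: "1 / real (Suc m) < s"
        using reals_Archimedean[OF \<open>0 < s\<close>] by (auto simp: inverse_eq_divide)
      have "\<bar>F \<omega> h - F \<omega> 0 - D \<omega> * h\<bar> \<le> \<bar>h\<bar> / real (Suc k)" if "\<bar>h\<bar> < 1 / real (Suc m)" for h
      proof (cases "h = 0")
        case False
        have "F \<omega> h - F \<omega> 0 - D \<omega> * h = h * ((F \<omega> h - F \<omega> 0) / h - d)"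
          using False by (simp add: \<open>D \<omega> = d\<close> field_simps)
        then show ?thesis
          using mult_left_mono[OF less_imp_le[OF s[OF False]], of "\<bar>h\<bar>"] that m
          by (simp add: abs_mult del: of_nat_Suc)
      qed simp
      then show "\<exists>m. \<forall>q. \<bar>real_of_rat q\<bar> < 1 / real (Suc m) \<longrightarrow>
          \<bar>F \<omega> (real_of_rat q) - F \<omega> 0 - D \<omega> * real_of_rat q\<bar> \<le> \<bar>real_of_rat q\<bar> / real (Suc k)"
        by blast
    qed
  qed
  \<comment> \<open>Without a derivative, \<open>deriv\<close> chooses from an empty predicate, and
    this choice is the same for all \<omega>.\<close>
  have "deriv (F \<omega>) 0 = (if S \<omega> then D \<omega> else (SOME d. False))" for \<omega>
  proof (cases "S \<omega>")
    case True
    then show ?thesis using S[THEN DERIV_imp_deriv] by simp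
  next
    case False
    then have "\<not> (F \<omega> has_real_derivative d) (at 0)" for d
      using D by blast
    then show ?thesis using False by (simp add: deriv_def)
  qed
  then show ?thesis by simp
qed

section \<open>Networks at Gaussian initialization\<close>

lemma prob_space_std_normal: "prob_space std_normal_distribution"
  by (rule prob_space_normal_density) simp

lemma prob_space_init_measure: "prob_space (init_measure L n)"
  unfolding init_measure_def by (intro prob_space_PiM prob_space_std_normal)

lemma integral_PiM_std_normal_iexp:
  assumes "finite I"
  shows "(\<integral>\<psi>. iexp (\<Sum>p\<in>I. c p * \<psi> p) \<partial>Pi\<^sub>M I (\<lambda>_. std_normal_distribution)) =
    complex_of_real (exp (- (\<Sum>p\<in>I. (c p)\<^sup>2) / 2))"
proof -
  interpret prob_space std_normal_distribution by (rule prob_space_std_normal)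
  interpret product_sigma_finite "\<lambda>_. std_normal_distribution" by standard
  have "(\<integral>\<psi>. iexp (\<Sum>p\<in>I. c p * \<psi> p) \<partial>Pi\<^sub>M I (\<lambda>_. std_normal_distribution)) =
     (\<integral>\<psi>. (\<Prod>p\<in>I. iexp (c p * \<psi> p)) \<partial>Pi\<^sub>M I (\<lambda>_. std_normal_distribution))"
    using assms by (simp add: exp_sum sum_distrib_left)
  also have "\<dots> = (\<Prod>p\<in>I. \<integral>y. iexp (c p * y) \<partial>std_normal_distribution)"
    using assms by (intro product_integral_prod integrable_const_bound[of _ 1]) auto
  also have "\<dots> = (\<Prod>p\<in>I. char std_normal_distribution (c p))"
    by (simp add: char_def)
  also have "\<dots> = complex_of_real (exp (\<Sum>p\<in>I. - (c p)\<^sup>2 / 2))"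
    using assms by (simp add: char_std_normal_distribution exp_sum)
  finally show ?thesis
    by (simp add: sum_negf sum_divide_distrib)
qed

text \<open>The coefficients \<open>r p\<close> see only coordinates outside \<open>K\<close>. With
  those frozen, the sum is exactly Gaussian with variance the sum of the squares of the
  \<open>r p\<close>, and Fubini over the splitting into \<open>J\<close> and \<open>K\<close> gives
  the claim. \<open>K\<close> will be the last layer.\<close>

lemma integral_PiM_std_normal_iexp_conditional:
  fixes r :: "'p \<Rightarrow> ('p \<Rightarrow> real) \<Rightarrow> real"
  assumes I: "I = J \<union> K" "J \<inter> K = {}" and fin: "finite J" "finite K"
    and r [measurable]: "\<And>p. p \<in> K \<Longrightarrow> r p \<in> borel_measurable (Pi\<^sub>M I (\<lambda>_. std_normal_distribution))"
    and indep: "\<And>p \<theta> \<theta>'. p \<in> K \<Longrightarrow> (\<And>q. q \<notin> K \<Longrightarrow> \<theta> q = \<theta>' q) \<Longrightarrow> r p \<theta> = r p \<theta>'"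
  shows "(\<integral>\<theta>. iexp (\<Sum>p\<in>K. \<theta> p * r p \<theta>) \<partial>Pi\<^sub>M I (\<lambda>_. std_normal_distribution)) =
    (\<integral>\<theta>. complex_of_real (exp (- (\<Sum>p\<in>K. (r p \<theta>)\<^sup>2) / 2)) \<partial>Pi\<^sub>M I (\<lambda>_. std_normal_distribution))"
proof -
  let ?M = "\<lambda>_::'p. std_normal_distribution"
  interpret product_sigma_finite ?M
    using prob_space_std_normal by (auto simp: product_sigma_finite_def prob_space_imp_sigma_finite)
  interpret PI: prob_space "Pi\<^sub>M I ?M" by (intro prob_space_PiM prob_space_std_normal)
  interpret PK: prob_space "Pi\<^sub>M K ?M" by (intro prob_space_PiM prob_space_std_normal)
  have comp [measurable]: "(\<lambda>\<theta>. \<theta> p) \<in> borel_measurable (Pi\<^sub>M I ?M)" if "p \<in> K" for p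
    using measurable_component_singleton[of p I ?M] that I by simp
  \<comment> \<open>The filler on \<open>K\<close> is immaterial, since \<open>r p\<close> ignores
    these coordinates.\<close>
  define c where "c x p = r p (merge J K (x, \<lambda>_. undefined))" for x p
  have c: "r p (merge J K (x, y)) = c x p" if "p \<in> K" for p x y
    unfolding c_def by (rule indep[OF that]) (auto simp: merge_def)
  have "(\<integral>\<theta>. iexp (\<Sum>p\<in>K. \<theta> p * r p \<theta>) \<partial>Pi\<^sub>M I ?M) =
    (\<integral>x. \<integral>y. iexp (\<Sum>p\<in>K. merge J K (x, y) p * r p (merge J K (x, y))) \<partial>Pi\<^sub>M K ?M \<partial>Pi\<^sub>M J ?M)"
    unfolding I(1)
    by (intro product_integral_fold I fin PI.integrable_const_bound[of _ 1, unfolded I(1)] r[unfolded I(1)] comp[unfolded I(1)]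
        borel_measurable_exp measurable_compose[OF _ borel_measurable_exp]) (use r comp in \<open>simp_all add: I(1)\<close>)
  also have "\<dots> = (\<integral>x. \<integral>y. iexp (\<Sum>p\<in>K. c x p * y p) \<partial>Pi\<^sub>M K ?M \<partial>Pi\<^sub>M J ?M)"
  proof -
    have "merge J K (x, y) p = y p" if "p \<in> K" for x y :: "'p \<Rightarrow> real" and p
      using I(2) that by (auto simp: merge_def)
    then show ?thesis
      by (intro Bochner_Integration.integral_cong refl arg_cong[where f = iexp] sum.cong) (simp add: c mult.commute)
  qed
  \<comment> \<open>The integral over \<open>y\<close> of a constant is put back, so that the
    splitting can be undone.\<close>
  also have "\<dots> = (\<integral>x. \<integral>y. complex_of_real (exp (- (\<Sum>p\<in>K. (r p (merge J K (x, y)))\<^sup>2) / 2)) \<partial>Pi\<^sub>M K ?M \<partial>Pi\<^sub>M J ?M)"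
    unfolding integral_PiM_std_normal_iexp[OF fin(2)] by (simp add: c PK.prob_space)
  also have "\<dots> = (\<integral>\<theta>. complex_of_real (exp (- (\<Sum>p\<in>K. (r p \<theta>)\<^sup>2) / 2)) \<partial>Pi\<^sub>M I ?M)"
    unfolding I(1)
    by (intro product_integral_fold[symmetric] I fin PI.integrable_const_bound[of _ 1, unfolded I(1)])
      (use r comp in \<open>simp_all add: I(1) sum_nonneg\<close>)
  finally show ?thesis .
qed

lemma finite_params: "finite (params L n :: 'd::finite param set)"
proof -
  have "params L n \<subseteq> (\<lambda>(i, j). InW i j) ` ({..<layer_width L n 1} \<times> UNIV) \<union>
     (\<lambda>(l, i, j). HidW l i j) ` ({..L} \<times> {..<Suc n} \<times> {..<n}) \<union>
     (\<lambda>(l, i). Bias l i) ` ({..L} \<times> {..<Suc n} :: (nat \<times> nat) set)"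
    unfolding params_def layer_width_def by (fastforce simp: image_iff split: if_splits)
  then show ?thesis
    by (rule finite_subset) auto
qed

section \<open>The network as a linear function of its last layer\<close>

definition last_params :: "nat \<Rightarrow> nat \<Rightarrow> 'd param set" where
  "last_params L n = {p \<in> params L n. param_layer p = L}"

lemma finite_last_params: "finite (last_params L n :: 'd::finite param set)"
  by (simp add: last_params_def finite_params)

text \<open>The factor that multiplies a last-layer parameter in the output. Among
  \<open>last_params\<close>, \<open>InW\<close> occurs only for \<open>L = 1\<close> and
  \<open>HidW\<close> only for \<open>L \<ge> 2\<close>. The neuron index is ignored because the
  output neuron is unique.\<close>

fun last_coeff ::
  "(real \<Rightarrow> real) \<Rightarrow> real \<Rightarrow> real \<Rightarrow> nat \<Rightarrow> nat \<Rightarrow> ('d::finite param \<Rightarrow> real) \<Rightarrow> real^'d \<Rightarrow> 'd param \<Rightarrow> real"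
where
  "last_coeff \<phi> \<sigma>\<^sub>w \<sigma>\<^sub>b L n \<theta> x (InW i j) = \<sigma>\<^sub>w / sqrt (real CARD('d)) * x $ j"
| "last_coeff \<phi> \<sigma>\<^sub>w \<sigma>\<^sub>b L n \<theta> x (HidW l i j) = \<sigma>\<^sub>w / sqrt (real n) * \<phi> (preact \<phi> \<sigma>\<^sub>w \<sigma>\<^sub>b n \<theta> x (L - 1) j)"
| "last_coeff \<phi> \<sigma>\<^sub>w \<sigma>\<^sub>b L n \<theta> x (Bias l i) = \<sigma>\<^sub>b"

lemma preact_cong:
  "(\<And>p. param_layer p \<le> l \<Longrightarrow> \<theta> p = \<theta>' p) \<Longrightarrow>
    preact \<phi> \<sigma>\<^sub>w \<sigma>\<^sub>b n \<theta> x l i = preact \<phi> \<sigma>\<^sub>w \<sigma>\<^sub>b n \<theta>' x l i"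
proof (induction \<phi> \<sigma>\<^sub>w \<sigma>\<^sub>b n \<theta> x l i rule: preact.induct)
  case (3 \<phi> \<sigma>\<^sub>w \<sigma>\<^sub>b n \<theta> x l i)
  have "preact \<phi> \<sigma>\<^sub>w \<sigma>\<^sub>b n \<theta> x (Suc l) j = preact \<phi> \<sigma>\<^sub>w \<sigma>\<^sub>b n \<theta>' x (Suc l) j" if "j < n" for j
    using that 3 by simp
  then show ?case
    using 3(2)[of "Bias (Suc (Suc l)) i"] 3(2)[of "HidW (Suc (Suc l)) i _"] by simp
qed simp_all

lemma last_coeff_cong:
  assumes "1 \<le> L" "\<And>p. param_layer p \<noteq> L \<Longrightarrow> \<theta> p = \<theta>' p"
  shows "last_coeff \<phi> \<sigma>\<^sub>w \<sigma>\<^sub>b L n \<theta> x p = last_coeff \<phi> \<sigma>\<^sub>w \<sigma>\<^sub>b L n \<theta>' x p"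
proof -
  have "preact \<phi> \<sigma>\<^sub>w \<sigma>\<^sub>b n \<theta> x (L - 1) j = preact \<phi> \<sigma>\<^sub>w \<sigma>\<^sub>b n \<theta>' x (L - 1) j" for j
    using assms by (intro preact_cong) auto
  then show ?thesis by (cases p) simp_all
qed

text \<open>No nonlinearity follows the last layer. The two cases differ because a single layer
  reads the input directly, whereas a deeper network reads \<phi> of the layer below.\<close>

lemma network_eq_sum_last_params:
  assumes "1 \<le> L"
  shows "network \<phi> \<sigma>\<^sub>w \<sigma>\<^sub>b L n \<theta> x = (\<Sum>p\<in>last_params L n. \<theta> p * last_coeff \<phi> \<sigma>\<^sub>w \<sigma>\<^sub>b L n \<theta> x p)"
proof -
  obtain k where L: "L = Suc k" using assms by (cases L) auto
  show ?thesis
  proof (cases k)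
    case 0
    have *: "last_params L n = insert (Bias 1 0) (range (InW 0) :: 'a param set)"
      unfolding last_params_def params_def layer_width_def L 0 by (auto simp: image_iff)
    have "inj (InW 0 :: 'a \<Rightarrow> 'a param)" by (simp add: inj_def)
    then show ?thesis
      unfolding * by (subst sum.insert) (auto simp: network_def L 0 sum.reindex sum_distrib_left mult_ac)
  next
    case (Suc l)
    have *: "last_params L n = insert (Bias L 0) (HidW L 0 ` {..<n} :: 'a param set)"
      unfolding last_params_def params_def layer_width_def L Suc by (auto simp: image_iff)
    have "inj_on (HidW L 0 :: nat \<Rightarrow> 'a param) {..<n}" by (simp add: inj_on_def)
    then show ?thesis
      unfolding * by (subst sum.insert) (auto simp: network_def L Suc sum.reindex sum_distrib_left mult_ac)
  qed
qed

text \<open>By linearity this derivative exists at every \<theta>, although \<phi> need not be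
  differentiable. Consequently the last-layer empirical kernel is exactly the conditional covariance
  of the network given its hidden layers.\<close>

lemma network_grad_last_params:
  assumes "1 \<le> L" and p: "p \<in> last_params L n"
  shows "network_grad \<phi> \<sigma>\<^sub>w \<sigma>\<^sub>b L n \<theta> x p = last_coeff \<phi> \<sigma>\<^sub>w \<sigma>\<^sub>b L n \<theta> x p"
proof -
  have "network \<phi> \<sigma>\<^sub>w \<sigma>\<^sub>b L n (\<theta>(p := t)) x = t * last_coeff \<phi> \<sigma>\<^sub>w \<sigma>\<^sub>b L n \<theta> x p +
      (\<Sum>q\<in>last_params L n - {p}. \<theta> q * last_coeff \<phi> \<sigma>\<^sub>w \<sigma>\<^sub>b L n \<theta> x q)" for t
  proof -
    have "last_coeff \<phi> \<sigma>\<^sub>w \<sigma>\<^sub>b L n (\<theta>(p := t)) x q = last_coeff \<phi> \<sigma>\<^sub>w \<sigma>\<^sub>b L n \<theta> x q" for q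
      using p by (intro last_coeff_cong[OF assms(1)]) (auto simp: last_params_def)
    then show ?thesis
      unfolding network_eq_sum_last_params[OF assms(1)] sum.remove[OF finite_last_params p] by simp
  qed
  then have "((\<lambda>t. network \<phi> \<sigma>\<^sub>w \<sigma>\<^sub>b L n (\<theta>(p := t)) x) has_real_derivative
      last_coeff \<phi> \<sigma>\<^sub>w \<sigma>\<^sub>b L n \<theta> x p) (at (\<theta> p))"
    by (auto intro!: derivative_eq_intros)
  then show ?thesis
    unfolding network_grad_def by (rule DERIV_imp_deriv)
qed

section \<open>Regularity in the parameters\<close>

lemma continuous_on_preact_param:
  assumes \<phi>: "continuous_on UNIV \<phi>"
  shows "continuous_on UNIV (\<lambda>t. preact \<phi> \<sigma>\<^sub>w \<sigma>\<^sub>b n (\<theta>(p := t)) x l i)"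
  using \<phi>
proof (induction \<phi> \<sigma>\<^sub>w \<sigma>\<^sub>b n \<theta> x l i rule: preact.induct)
  case (2 \<phi> \<sigma>\<^sub>w \<sigma>\<^sub>b n \<theta> x i)
  have "continuous_on UNIV (\<lambda>t. (\<theta>(p := t)) q)" for q
    by (cases "q = p") auto
  then show ?case
    unfolding preact.simps by (intro continuous_intros)
next
  case (3 \<phi> \<sigma>\<^sub>w \<sigma>\<^sub>b n \<theta> x l i)
  have "continuous_on UNIV (\<lambda>t. (\<theta>(p := t)) q)" for q
    by (cases "q = p") auto
  moreover have "continuous_on UNIV (\<lambda>t. \<phi> (preact \<phi> \<sigma>\<^sub>w \<sigma>\<^sub>b n (\<theta>(p := t)) x (Suc l) j))" if "j < n" for j
    using 3 that by (intro continuous_on_compose2[OF 3(2)]) (auto simp: fun_upd_def)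
  ultimately show ?case
    unfolding preact.simps by (intro continuous_intros) auto
qed simp

lemma measurable_param [measurable (raw)]:
  "p \<in> params L n \<Longrightarrow> (\<lambda>\<theta>. \<theta> p) \<in> borel_measurable (init_measure L n)"
  using measurable_component_singleton[of p "params L n" "\<lambda>_. std_normal_distribution"] by (simp add: init_measure_def)

lemma borel_measurable_preact:
  fixes x :: "real^'d"
  assumes \<phi>: "\<phi> \<in> borel_measurable borel"
  shows "l \<le> L \<Longrightarrow> i < layer_width L n l \<Longrightarrow>
    (\<lambda>\<theta>. preact \<phi> \<sigma>\<^sub>w \<sigma>\<^sub>b n \<theta> x l i) \<in> borel_measurable (init_measure L n)"
proof (induction l arbitrary: i rule: less_induct)
  case (less l)
  have b: "Bias l i \<in> (params L n :: 'd param set)" if "1 \<le> l"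
    using less.prems that by (auto simp: params_def)
  consider "l = 0" | "l = 1" | k where "l = Suc (Suc k)"
    by (metis One_nat_def not0_implies_Suc)
  then show ?case
  proof cases
    case 1
    then show ?thesis by simp
  next
    case 2
    have "InW i j \<in> params L n" for j :: 'd
      using less.prems 2 by (auto simp: params_def)
    then show ?thesis
      using b 2 by (simp add: measurable_param)
  next
    case 3
    have "HidW l i j \<in> (params L n :: 'd param set)" if "j < n" for j
      using less.prems 3 that by (auto simp: params_def)
    moreover have "(\<lambda>\<theta>. \<phi> (preact \<phi> \<sigma>\<^sub>w \<sigma>\<^sub>b n \<theta> x (Suc k) j)) \<in> borel_measurable (init_measure L n)" if "j < n" for j
      using less.prems 3 that by (intro measurable_compose[OF less.IH \<phi>]) (auto simp: layer_width_def)
    ultimately show ?thesis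
      using b 3 by (auto intro!: borel_measurable_add borel_measurable_times borel_measurable_sum measurable_param)
  qed
qed

lemma borel_measurable_network:
  assumes "\<phi> \<in> borel_measurable borel"
  shows "(\<lambda>\<theta>. network \<phi> \<sigma>\<^sub>w \<sigma>\<^sub>b L n \<theta> x) \<in> borel_measurable (init_measure L n)"
  unfolding network_def using assms by (intro borel_measurable_preact) (auto simp: layer_width_def)

lemma borel_measurable_network_grad:
  fixes x :: "real^'d"
  assumes \<phi>: "continuous_on UNIV \<phi>" and p: "p \<in> params L n"
  shows "(\<lambda>\<theta>. network_grad \<phi> \<sigma>\<^sub>w \<sigma>\<^sub>b L n \<theta> x p) \<in> borel_measurable (init_measure L n)"
proof -
  \<comment> \<open>The point of differentiation \<open>\<theta> p\<close> moves with \<theta>; in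
    terms of the increment the derivative is always taken at 0, as
    \<open>borel_measurable_deriv\<close> requires.\<close>
  define F where "F \<theta> h = network \<phi> \<sigma>\<^sub>w \<sigma>\<^sub>b L n (\<theta>(p := h + \<theta> p)) x" for \<theta> h
  have "(\<lambda>\<theta>. deriv (F \<theta>) 0) \<in> borel_measurable (init_measure L n)"
  proof (rule borel_measurable_deriv)
    fix h
    have "(\<lambda>\<theta>. \<theta>(p := h + \<theta> p)) \<in> init_measure L n \<rightarrow>\<^sub>M init_measure L n"
      using p measurable_param[OF p] unfolding init_measure_def
      by (intro measurable_fun_upd[where J = "params L n"]) auto
    from measurable_compose[OF this borel_measurable_network[OF borel_measurable_continuous_onI[OF \<phi>]]]
    show "(\<lambda>\<theta>. F \<theta> h) \<in> borel_measurable (init_measure L n)"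
      unfolding F_def .
  next
    fix \<theta>
    show "continuous_on UNIV (F \<theta>)"
      unfolding F_def network_def
      by (rule continuous_on_compose2[OF continuous_on_preact_param[OF \<phi>]]) (auto intro!: continuous_intros)
  qed
  moreover have "network_grad \<phi> \<sigma>\<^sub>w \<sigma>\<^sub>b L n \<theta> x p = deriv (F \<theta>) 0" for \<theta>
    unfolding network_grad_def deriv_def F_def
    using DERIV_shift[of "\<lambda>t. network \<phi> \<sigma>\<^sub>w \<sigma>\<^sub>b L n (\<theta>(p := t)) x" _ 0 "\<theta> p"] by simp
  ultimately show ?thesis by simp
qed

section \<open>The infinite-width limit\<close>

text \<open>Empirical kernels are Gram matrices of gradients, so their quadratic forms are sums of
  squares. This is the shape in which variances come out of the Gaussian integrals.\<close>

lemma empirical_quadratic_form: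
  fixes x :: "'j \<Rightarrow> real^'d"
  shows "(\<Sum>i\<in>J. \<Sum>j\<in>J. a i * a j * empirical_ntk \<phi> \<sigma>\<^sub>w \<sigma>\<^sub>b L n \<theta> (x i) (x j)) =
      (\<Sum>p\<in>params L n. (\<Sum>j\<in>J. a j * network_grad \<phi> \<sigma>\<^sub>w \<sigma>\<^sub>b L n \<theta> (x j) p)\<^sup>2)" (is ?A)
    and "(\<Sum>i\<in>J. \<Sum>j\<in>J. a i * a j * empirical_layer_ntk \<phi> \<sigma>\<^sub>w \<sigma>\<^sub>b L n L \<theta> (x i) (x j)) =
      (\<Sum>p\<in>last_params L n. (\<Sum>j\<in>J. a j * network_grad \<phi> \<sigma>\<^sub>w \<sigma>\<^sub>b L n \<theta> (x j) p)\<^sup>2)" (is ?B)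
proof -
  have *: "(\<Sum>i\<in>J. \<Sum>j\<in>J. a i * a j * (\<Sum>p\<in>S. g i p * g j p)) = (\<Sum>p\<in>S. (\<Sum>j\<in>J. a j * g j p)\<^sup>2)"
    for S :: "'d param set" and g :: "'j \<Rightarrow> 'd param \<Rightarrow> real"
  proof -
    have "(\<Sum>i\<in>J. \<Sum>j\<in>J. a i * a j * (\<Sum>p\<in>S. g i p * g j p)) =
        (\<Sum>i\<in>J. \<Sum>j\<in>J. \<Sum>p\<in>S. (a i * g i p) * (a j * g j p))"
      by (simp add: sum_distrib_left mult_ac)
    also have "\<dots> = (\<Sum>i\<in>J. \<Sum>p\<in>S. \<Sum>j\<in>J. (a i * g i p) * (a j * g j p))"
      by (intro sum.cong refl sum.swap)
    also have "\<dots> = (\<Sum>p\<in>S. \<Sum>i\<in>J. \<Sum>j\<in>J. (a i * g i p) * (a j * g j p))"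
      by (rule sum.swap)
    finally show ?thesis
      by (simp add: power2_eq_square sum_product)
  qed
  show ?A ?B
    unfolding empirical_ntk_def empirical_layer_ntk_def last_params_def * by (rule refl)+
qed

lemma borel_measurable_empirical_ntk:
  assumes "continuous_on UNIV \<phi>"
  shows "(\<lambda>\<theta>. empirical_ntk \<phi> \<sigma>\<^sub>w \<sigma>\<^sub>b L n \<theta> x y) \<in> borel_measurable (init_measure L n)"
    "(\<lambda>\<theta>. empirical_layer_ntk \<phi> \<sigma>\<^sub>w \<sigma>\<^sub>b L n l \<theta> x y) \<in> borel_measurable (init_measure L n)"
  unfolding empirical_ntk_def empirical_layer_ntk_def
  by (auto intro!: borel_measurable_sum borel_measurable_times borel_measurable_network_grad assms)

lemma is_ntk_sym:
  assumes "continuous_on UNIV \<phi>" "is_ntk \<phi> \<sigma>\<^sub>w \<sigma>\<^sub>b L \<Theta>"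
  shows "\<Theta> x y = \<Theta> y x"
proof (rule tendsto_in_prob_unique[OF prob_space_init_measure])
  show "tendsto_in_prob (init_measure L) (\<lambda>n \<theta>. empirical_ntk \<phi> \<sigma>\<^sub>w \<sigma>\<^sub>b L n \<theta> x y) (\<Theta> x y)"
    using assms(2) by (simp add: is_ntk_def)
  have "empirical_ntk \<phi> \<sigma>\<^sub>w \<sigma>\<^sub>b L n \<theta> x y = empirical_ntk \<phi> \<sigma>\<^sub>w \<sigma>\<^sub>b L n \<theta> y x" for n \<theta>
    by (simp add: empirical_ntk_def mult.commute)
  then show "tendsto_in_prob (init_measure L) (\<lambda>n \<theta>. empirical_ntk \<phi> \<sigma>\<^sub>w \<sigma>\<^sub>b L n \<theta> x y) (\<Theta> y x)"
    using assms(2) by (simp add: is_ntk_def)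
qed (rule borel_measurable_empirical_ntk[OF assms(1)])

text \<open>Given \<open>\<theta>\<close>, the combination of \<open>g_tilde\<close> is Gaussian in \<open>\<psi>\<close>; given the hidden layers, the
  combination of \<open>network\<close> is Gaussian in the last layer. The conditional variances are \<open>E - R\<close>
  and \<open>R\<close>.\<close>

lemma
  fixes x :: "'j \<Rightarrow> real^'d" and a :: "'j \<Rightarrow> real" and \<sigma>\<^sub>w \<sigma>\<^sub>b :: real
  assumes \<phi>: "continuous_on UNIV \<phi>" and L: "1 \<le> L" and J: "finite J"
  defines "E \<equiv> \<lambda>n \<theta>. \<Sum>i\<in>J. \<Sum>j\<in>J. a i * a j * empirical_ntk \<phi> \<sigma>\<^sub>w \<sigma>\<^sub>b L n \<theta> (x i) (x j)"
    and "R \<equiv> \<lambda>n \<theta>. \<Sum>i\<in>J. \<Sum>j\<in>J. a i * a j * empirical_layer_ntk \<phi> \<sigma>\<^sub>w \<sigma>\<^sub>b L n L \<theta> (x i) (x j)"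
    and "S \<equiv> \<lambda>n \<theta>. \<Sum>j\<in>J. a j * network \<phi> \<sigma>\<^sub>w \<sigma>\<^sub>b L n \<theta> (x j)"
  shows char_network: "(\<integral>\<theta>. iexp (S n \<theta>) \<partial>init_measure L n) =
      (\<integral>\<theta>. complex_of_real (exp (- R n \<theta> / 2)) \<partial>init_measure L n)" (is ?A)
    and char_network_g_tilde: "(\<integral>(\<theta>, \<psi>). iexp (\<Sum>j\<in>J. a j * (network \<phi> \<sigma>\<^sub>w \<sigma>\<^sub>b L n \<theta> (x j) - g_tilde \<phi> \<sigma>\<^sub>w \<sigma>\<^sub>b L n \<theta> \<psi> (x j)))
        \<partial>(init_measure L n \<Otimes>\<^sub>M init_measure L n)) =
      (\<integral>\<theta>. iexp (S n \<theta>) * complex_of_real (exp (- (E n \<theta> - R n \<theta>) / 2)) \<partial>init_measure L n)" (is ?B)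
    and variance_nonneg: "R n \<theta> \<le> E n \<theta>" "0 \<le> R n \<theta>"
proof -
  let ?M = "init_measure L n :: ('d param \<Rightarrow> real) measure"
  interpret M: prob_space ?M by (rule prob_space_init_measure)
  interpret pair_prob_space ?M ?M ..
  define g where "g \<theta> p = (\<Sum>j\<in>J. a j * network_grad \<phi> \<sigma>\<^sub>w \<sigma>\<^sub>b L n \<theta> (x j) p)" for \<theta> p
  \<comment> \<open>Coefficient of \<open>\<psi> p\<close> in the combination: negative because
    \<open>g_tilde\<close> is subtracted, zero where \<open>drop_last_layer\<close> erases
    \<psi>.\<close>
  define c where "c \<theta> p = (if param_layer p = L then 0 else - g \<theta> p)" for \<theta> p
  have R: "R n \<theta> = (\<Sum>p\<in>last_params L n. (g \<theta> p)\<^sup>2)" for \<theta>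
    unfolding R_def g_def by (rule empirical_quadratic_form(2))
  have E: "E n \<theta> = (\<Sum>p\<in>params L n. (g \<theta> p)\<^sup>2)" for \<theta>
    unfolding E_def g_def by (rule empirical_quadratic_form(1))
  have last: "last_params L n \<subseteq> (params L n :: 'd param set)"
    by (auto simp: last_params_def)
  have ER: "E n \<theta> - R n \<theta> = (\<Sum>p\<in>params L n. (c \<theta> p)\<^sup>2)" for \<theta>
  proof -
    have "E n \<theta> - R n \<theta> = (\<Sum>p\<in>params L n - last_params L n. (g \<theta> p)\<^sup>2)"
      unfolding E R using sum_diff[OF finite_params last, of "\<lambda>p. (g \<theta> p)\<^sup>2"] by simp
    also have "\<dots> = (\<Sum>p\<in>params L n. (c \<theta> p)\<^sup>2)"
      by (intro sum.mono_neutral_cong_left finite_params) (auto simp: c_def last_params_def)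
    finally show ?thesis .
  qed
  have "0 \<le> E n \<theta> - R n \<theta>"
    unfolding ER by (rule sum_nonneg) simp
  then show "R n \<theta> \<le> E n \<theta>"
    by simp
  show "0 \<le> R n \<theta>"
    unfolding R by (rule sum_nonneg) simp
  have g_meas [measurable]: "(\<lambda>\<theta>. g \<theta> p) \<in> borel_measurable ?M" if "p \<in> params L n" for p
    unfolding g_def using that
    by (intro borel_measurable_sum borel_measurable_times borel_measurable_const borel_measurable_network_grad \<phi>)
  have c_meas [measurable]: "(\<lambda>\<theta>. c \<theta> p) \<in> borel_measurable ?M" if "p \<in> params L n" for p
    unfolding c_def using that by (cases "param_layer p = L") simp_all
  have S_meas [measurable]: "S n \<in> borel_measurable ?M"
    unfolding S_def
    by (intro borel_measurable_sum borel_measurable_times borel_measurable_const borel_measurable_network borel_measurable_continuous_onI \<phi>)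
  have S: "S n \<theta> = (\<Sum>p\<in>last_params L n. \<theta> p * g \<theta> p)" for \<theta>
  proof -
    have "S n \<theta> = (\<Sum>j\<in>J. \<Sum>p\<in>last_params L n. \<theta> p * (a j * network_grad \<phi> \<sigma>\<^sub>w \<sigma>\<^sub>b L n \<theta> (x j) p))"
      unfolding S_def network_eq_sum_last_params[OF L]
      by (simp add: sum_distrib_left network_grad_last_params[OF L] mult_ac)
    also have "\<dots> = (\<Sum>p\<in>last_params L n. \<theta> p * g \<theta> p)"
      unfolding g_def by (subst sum.swap) (simp add: sum_distrib_left)
    finally show ?thesis .
  qed
  show ?A
    unfolding S R init_measure_def
  proof (rule integral_PiM_std_normal_iexp_conditional[where J = "params L n - last_params L n"])
    fix p :: "'d param" and \<theta> \<theta>' :: "'d param \<Rightarrow> real"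
    assume p: "p \<in> last_params L n" and eq: "\<And>q. q \<notin> last_params L n \<Longrightarrow> \<theta> q = \<theta>' q"
    have "last_coeff \<phi> \<sigma>\<^sub>w \<sigma>\<^sub>b L n \<theta> (x j) p = last_coeff \<phi> \<sigma>\<^sub>w \<sigma>\<^sub>b L n \<theta>' (x j) p" for j
      using eq by (intro last_coeff_cong[OF L]) (auto simp: last_params_def)
    then show "g \<theta> p = g \<theta>' p"
      unfolding g_def by (simp add: network_grad_last_params[OF L p])
  qed (use last g_meas in \<open>auto simp: finite_params finite_last_params init_measure_def\<close>)
  have exponent: "(\<Sum>j\<in>J. a j * (network \<phi> \<sigma>\<^sub>w \<sigma>\<^sub>b L n \<theta> (x j) - g_tilde \<phi> \<sigma>\<^sub>w \<sigma>\<^sub>b L n \<theta> \<psi> (x j))) =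
      S n \<theta> + (\<Sum>p\<in>params L n. c \<theta> p * \<psi> p)" for \<theta> \<psi>
  proof -
    have "(\<Sum>j\<in>J. a j * g_tilde \<phi> \<sigma>\<^sub>w \<sigma>\<^sub>b L n \<theta> \<psi> (x j)) =
        (\<Sum>j\<in>J. \<Sum>p\<in>params L n. (a j * network_grad \<phi> \<sigma>\<^sub>w \<sigma>\<^sub>b L n \<theta> (x j) p) * drop_last_layer L \<psi> p)"
      by (simp add: g_tilde_def sum_distrib_left mult.assoc)
    also have "\<dots> = (\<Sum>p\<in>params L n. g \<theta> p * drop_last_layer L \<psi> p)"
      unfolding g_def by (subst sum.swap) (simp add: sum_distrib_right)
    also have "\<dots> = - (\<Sum>p\<in>params L n. c \<theta> p * \<psi> p)"
      unfolding sum_negf[symmetric] by (intro sum.cong) (auto simp: c_def drop_last_layer_def)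
    finally show ?thesis
      by (simp add: S_def right_diff_distrib sum_subtractf)
  qed
  have "(\<integral>(\<theta>, \<psi>). iexp (\<Sum>j\<in>J. a j * (network \<phi> \<sigma>\<^sub>w \<sigma>\<^sub>b L n \<theta> (x j) - g_tilde \<phi> \<sigma>\<^sub>w \<sigma>\<^sub>b L n \<theta> \<psi> (x j))) \<partial>(?M \<Otimes>\<^sub>M ?M)) =
      (\<integral>\<omega>. iexp (S n (fst \<omega>) + (\<Sum>p\<in>params L n. c (fst \<omega>) p * snd \<omega> p)) \<partial>(?M \<Otimes>\<^sub>M ?M))"
    unfolding exponent by (simp add: case_prod_beta')
  \<comment> \<open>With \<theta> frozen, the network is a constant phase that leaves the inner
    integral, and the rest is Gaussian in \<psi>.\<close>
  also have "\<dots> = (\<integral>\<theta>. \<integral>\<psi>. iexp (S n \<theta> + (\<Sum>p\<in>params L n. c \<theta> p * \<psi> p)) \<partial>?M \<partial>?M)"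
  proof -
    have [measurable]: "(\<lambda>\<omega>. snd \<omega> p) \<in> borel_measurable (?M \<Otimes>\<^sub>M ?M)" if "p \<in> params L n" for p
      using measurable_compose[OF measurable_snd measurable_param[OF that]] .
    have [measurable]: "(\<lambda>\<omega>. c (fst \<omega>) p) \<in> borel_measurable (?M \<Otimes>\<^sub>M ?M)" if "p \<in> params L n" for p
      using measurable_compose[OF measurable_fst c_meas[OF that]] .
    have "integrable (?M \<Otimes>\<^sub>M ?M) (\<lambda>\<omega>. iexp (S n (fst \<omega>) + (\<Sum>p\<in>params L n. c (fst \<omega>) p * snd \<omega> p)))"
      by (rule integrable_const_bound[of _ 1]) (simp, measurable)
    from integral_fst'[OF this] show ?thesis by simp
  qed
  also have "\<dots> = (\<integral>\<theta>. iexp (S n \<theta>) * complex_of_real (exp (- (E n \<theta> - R n \<theta>) / 2)) \<partial>?M)"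
  proof (rule Bochner_Integration.integral_cong[OF refl])
    fix \<theta>
    have "(\<integral>\<psi>. iexp (S n \<theta> + (\<Sum>p\<in>params L n. c \<theta> p * \<psi> p)) \<partial>?M) =
        (\<integral>\<psi>. iexp (S n \<theta>) * iexp (\<Sum>p\<in>params L n. c \<theta> p * \<psi> p) \<partial>?M)"
      unfolding of_real_add distrib_left exp_add ..
    also have "\<dots> = iexp (S n \<theta>) * (\<integral>\<psi>. iexp (\<Sum>p\<in>params L n. c \<theta> p * \<psi> p) \<partial>?M)"
      by (rule integral_mult_right_zero)
    also have "(\<integral>\<psi>. iexp (\<Sum>p\<in>params L n. c \<theta> p * \<psi> p) \<partial>?M) = complex_of_real (exp (- (E n \<theta> - R n \<theta>) / 2))"
      unfolding ER init_measure_def by (rule integral_PiM_std_normal_iexp[OF finite_params])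
    finally show "(\<integral>\<psi>. iexp (S n \<theta> + (\<Sum>p\<in>params L n. c \<theta> p * \<psi> p)) \<partial>?M) =
        iexp (S n \<theta>) * complex_of_real (exp (- (E n \<theta> - R n \<theta>) / 2))" .
  qed
  finally show ?B .
qed

text \<open>The phase of \<open>S\<close> and the factor exp(-(E-R)/2) both depend on \<theta>.
  Since the phase has modulus 1, the factor may be replaced by its constant limit at an L1 cost
  tending to 0. The remaining mean of the phase tends to exp(-r/2), and in the product the
  last-layer share \<open>r\<close> cancels.\<close>

lemma char_network_g_tilde_tendsto:
  fixes x :: "'j \<Rightarrow> real^'d"
  assumes \<phi>: "continuous_on UNIV \<phi>" and L: "1 \<le> L" and J: "finite J"
    and layer_limits: "layer_ntk_limits_exist TYPE('d) \<phi> \<sigma>\<^sub>w \<sigma>\<^sub>b L"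
    and ntk: "is_ntk \<phi> \<sigma>\<^sub>w \<sigma>\<^sub>b L \<Theta>"
  shows "(\<lambda>n. \<integral>(\<theta>, \<psi>). iexp (\<Sum>j\<in>J. a j * (network \<phi> \<sigma>\<^sub>w \<sigma>\<^sub>b L n \<theta> (x j) - g_tilde \<phi> \<sigma>\<^sub>w \<sigma>\<^sub>b L n \<theta> \<psi> (x j)))
        \<partial>(init_measure L n \<Otimes>\<^sub>M init_measure L n))
      \<longlonglongrightarrow> complex_of_real (exp (- (\<Sum>i\<in>J. \<Sum>j\<in>J. a i * a j * \<Theta> (x i) (x j)) / 2))"
proof -
  define E where "E n \<theta> = (\<Sum>i\<in>J. \<Sum>j\<in>J. a i * a j * empirical_ntk \<phi> \<sigma>\<^sub>w \<sigma>\<^sub>b L n \<theta> (x i) (x j))" for n \<theta>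
  define R where "R n \<theta> = (\<Sum>i\<in>J. \<Sum>j\<in>J. a i * a j * empirical_layer_ntk \<phi> \<sigma>\<^sub>w \<sigma>\<^sub>b L n L \<theta> (x i) (x j))" for n \<theta>
  define S where "S n \<theta> = (\<Sum>j\<in>J. a j * network \<phi> \<sigma>\<^sub>w \<sigma>\<^sub>b L n \<theta> (x j))" for n \<theta>
  define e where "e = (\<Sum>i\<in>J. \<Sum>j\<in>J. a i * a j * \<Theta> (x i) (x j))"
  let ?M = "\<lambda>n. init_measure L n :: ('d param \<Rightarrow> real) measure"
  note prob = prob_space_init_measure
  note emp_meas = borel_measurable_empirical_ntk[OF \<phi>]
  have [measurable]: "E n \<in> borel_measurable (?M n)" "R n \<in> borel_measurable (?M n)" for n
    unfolding E_def R_def by (intro borel_measurable_sum borel_measurable_times borel_measurable_const emp_meas)+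
  have [measurable]: "S n \<in> borel_measurable (?M n)" for n
    unfolding S_def
    by (intro borel_measurable_sum borel_measurable_times borel_measurable_const borel_measurable_network borel_measurable_continuous_onI \<phi>)
  have RE: "R n \<theta> \<le> E n \<theta>" "0 \<le> R n \<theta>" for n \<theta>
    unfolding E_def R_def by (rule variance_nonneg[OF \<phi> L J])+
  have "\<forall>i j. \<exists>c. tendsto_in_prob (init_measure L)
      (\<lambda>n \<theta>. empirical_layer_ntk \<phi> \<sigma>\<^sub>w \<sigma>\<^sub>b L n L \<theta> (x i) (x j)) c"
    using layer_limits L unfolding layer_ntk_limits_exist_def by simp
  then obtain k where k: "\<And>i j. tendsto_in_prob (init_measure L)
      (\<lambda>n \<theta>. empirical_layer_ntk \<phi> \<sigma>\<^sub>w \<sigma>\<^sub>b L n L \<theta> (x i) (x j)) (k i j)"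
    unfolding choice_iff by blast
  define r where "r = (\<Sum>i\<in>J. \<Sum>j\<in>J. a i * a j * k i j)"
  have R_lim: "tendsto_in_prob ?M R r"
    unfolding R_def r_def
    by (intro tendsto_in_prob_sum prob J tendsto_in_prob_cmult k borel_measurable_sum borel_measurable_times borel_measurable_const emp_meas)
  have E_lim: "tendsto_in_prob ?M E e"
    unfolding E_def e_def using ntk
    by (intro tendsto_in_prob_sum prob J tendsto_in_prob_cmult borel_measurable_sum borel_measurable_times borel_measurable_const emp_meas)
      (simp add: is_ntk_def)
  have "tendsto_in_prob ?M (\<lambda>n \<theta>. E n \<theta> + (- 1) * R n \<theta>) (e + (- 1) * r)"
    by (intro tendsto_in_prob_add prob tendsto_in_prob_cmult E_lim R_lim) measurable
  then have Q_lim: "tendsto_in_prob ?M (\<lambda>n \<theta>. E n \<theta> - R n \<theta>) (e - r)"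
    by simp
  have Q_abs: "(\<lambda>n. \<integral>\<theta>. \<bar>exp (- (E n \<theta> - R n \<theta>) / 2) - exp (- (e - r) / 2)\<bar> \<partial>?M n) \<longlonglongrightarrow> 0"
    using RE by (intro tendsto_in_prob_exp_neg prob Q_lim tendsto_in_prob_nonneg[OF prob _ Q_lim]) auto
  have R_abs: "(\<lambda>n. \<integral>\<theta>. \<bar>exp (- R n \<theta> / 2) - exp (- r / 2)\<bar> \<partial>?M n) \<longlonglongrightarrow> 0"
    using RE by (intro tendsto_in_prob_exp_neg prob R_lim tendsto_in_prob_nonneg[OF prob _ R_lim]) auto
  have exp_int: "integrable (?M n) (\<lambda>\<theta>. exp (- f \<theta> / 2))"
    if [measurable]: "f \<in> borel_measurable (?M n)" and "\<And>\<theta>. 0 \<le> f \<theta>" for f :: "_ \<Rightarrow> real" and n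
  proof -
    interpret prob_space "?M n" by (rule prob)
    show ?thesis
      by (rule integrable_const_bound[of _ 1]) (auto simp: that)
  qed
  \<comment> \<open>Replacing the random factor by a constant under any unimodular \<open>Z\<close>.
    It is used with the phase of the network and, for the mean of the phase itself, with
    \<open>Z = 1\<close>.\<close>
  have dist_le: "cmod ((\<integral>\<theta>. Z \<theta> * complex_of_real (exp (- f \<theta> / 2)) \<partial>?M n) - (\<integral>\<theta>. Z \<theta> \<partial>?M n) * complex_of_real (exp (- d / 2)))
      \<le> (\<integral>\<theta>. \<bar>exp (- f \<theta> / 2) - exp (- d / 2)\<bar> \<partial>?M n)"
    if [measurable]: "f \<in> borel_measurable (?M n)" "Z \<in> borel_measurable (?M n)" and f: "\<And>\<theta>. 0 \<le> f \<theta>" and Z: "\<And>\<theta>. cmod (Z \<theta>) = 1" for f :: "_ \<Rightarrow> real" and Z d n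
  proof -
    interpret prob_space "?M n" by (rule prob)
    have "integrable (?M n) (\<lambda>\<theta>. Z \<theta> * complex_of_real (exp (- f \<theta> / 2)))" "integrable (?M n) Z"
      by (rule integrable_const_bound[of _ 1]; simp add: Z f norm_mult)+
    then have "(\<integral>\<theta>. Z \<theta> * complex_of_real (exp (- f \<theta> / 2)) \<partial>?M n) - (\<integral>\<theta>. Z \<theta> \<partial>?M n) * complex_of_real (exp (- d / 2))
        = (\<integral>\<theta>. Z \<theta> * complex_of_real (exp (- f \<theta> / 2)) - Z \<theta> * complex_of_real (exp (- d / 2)) \<partial>?M n)"
      by (simp del: of_real_exp)
    also have "cmod \<dots> \<le> (\<integral>\<theta>. cmod (Z \<theta> * complex_of_real (exp (- f \<theta> / 2)) - Z \<theta> * complex_of_real (exp (- d / 2))) \<partial>?M n)"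
      by (rule integral_norm_bound)
    also have "\<dots> = (\<integral>\<theta>. \<bar>exp (- f \<theta> / 2) - exp (- d / 2)\<bar> \<partial>?M n)"
      unfolding right_diff_distrib[symmetric] of_real_diff[symmetric] norm_mult Z norm_of_real by simp
    finally show ?thesis .
  qed
  define A where "A n = (\<integral>\<theta>. iexp (S n \<theta>) \<partial>?M n)" for n
  have A_eq: "A n = (\<integral>\<theta>. 1 * complex_of_real (exp (- R n \<theta> / 2)) \<partial>?M n)" for n
    unfolding A_def S_def R_def mult_1 by (rule char_network[OF \<phi> L J])
  have "A \<longlonglongrightarrow> complex_of_real (exp (- r / 2))"
  proof (rule LIM_zero_cancel, rule Lim_null_comparison[OF _ R_abs], rule always_eventually, rule allI)
    fix n
    interpret prob_space "?M n" by (rule prob)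
    show "cmod (A n - complex_of_real (exp (- r / 2))) \<le> (\<integral>\<theta>. \<bar>exp (- R n \<theta> / 2) - exp (- r / 2)\<bar> \<partial>?M n)"
      using dist_le[of "R n" n "\<lambda>_. 1" r] RE unfolding A_eq by (simp add: prob_space)
  qed
  from tendsto_mult_left[OF this, of "complex_of_real (exp (- (e - r) / 2))"]
  have lim: "(\<lambda>n. A n * complex_of_real (exp (- (e - r) / 2))) \<longlonglongrightarrow> complex_of_real (exp (- e / 2))"
    by (simp add: mult.commute diff_divide_distrib flip: of_real_mult exp_add del: of_real_exp)
  have "(\<lambda>n. (\<integral>\<theta>. iexp (S n \<theta>) * complex_of_real (exp (- (E n \<theta> - R n \<theta>) / 2)) \<partial>?M n)
      - A n * complex_of_real (exp (- (e - r) / 2))) \<longlonglongrightarrow> 0"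
    unfolding A_def using RE
    by (intro Lim_null_comparison[OF _ Q_abs] always_eventually allI dist_le) auto
  from tendsto_add[OF this lim]
  have "(\<lambda>n. \<integral>\<theta>. iexp (S n \<theta>) * complex_of_real (exp (- (E n \<theta> - R n \<theta>) / 2)) \<partial>?M n) \<longlonglongrightarrow> complex_of_real (exp (- e / 2))"
    by simp
  then show ?thesis
    unfolding char_network_g_tilde[OF \<phi> L J] E_def R_def S_def e_def .
qed

text \<open>The limit is tested against bounded continuous real functions, so the cosine and the
  sine of the combination are passed to the limit separately and then reassembled.\<close>

lemma infinite_width_limit_char:
  fixes x :: "'j \<Rightarrow> real^'d"
  assumes \<phi>: "continuous_on UNIV \<phi>" and L: "1 \<le> L" and J: "finite J"
    and layer_limits: "layer_ntk_limits_exist TYPE('d) \<phi> \<sigma>\<^sub>w \<sigma>\<^sub>b L"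
    and ntk: "is_ntk \<phi> \<sigma>\<^sub>w \<sigma>\<^sub>b L \<Theta>"
    and lim: "infinite_width_limit \<phi> \<sigma>\<^sub>w \<sigma>\<^sub>b L P U G"
  shows "(\<integral>\<omega>. iexp (\<Sum>j\<in>J. a j * (U (x j) \<omega> - G (x j) \<omega>)) \<partial>P) =
    complex_of_real (exp (- (\<Sum>i\<in>J. \<Sum>j\<in>J. a i * a j * \<Theta> (x i) (x j)) / 2))"
proof -
  let ?M = "\<lambda>n. init_measure L n \<Otimes>\<^sub>M init_measure L n :: (('d param \<Rightarrow> real) \<times> ('d param \<Rightarrow> real)) measure"
  let ?T = "\<lambda>n (\<theta>, \<psi>). \<Sum>j\<in>J. a j * (network \<phi> \<sigma>\<^sub>w \<sigma>\<^sub>b L n \<theta> (x j) - g_tilde \<phi> \<sigma>\<^sub>w \<sigma>\<^sub>b L n \<theta> \<psi> (x j))"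
  define T where "T \<omega> = (\<Sum>j\<in>J. a j * (U (x j) \<omega> - G (x j) \<omega>))" for \<omega>
  interpret P: prob_space P
    using lim by (simp add: infinite_width_limit_def)
  have [measurable]: "U y \<in> borel_measurable P" "G y \<in> borel_measurable P" for y
    using lim by (simp_all add: infinite_width_limit_def)
  have T_meas [measurable]: "T \<in> borel_measurable P"
    unfolding T_def by measurable
  have Tn_meas [measurable]: "?T n \<in> borel_measurable (?M n)" for n
  proof -
    have [measurable]: "(\<lambda>\<theta>. network \<phi> \<sigma>\<^sub>w \<sigma>\<^sub>b L n \<theta> y) \<in> borel_measurable (init_measure L n)" for y :: "real^'d"
      by (intro borel_measurable_network borel_measurable_continuous_onI \<phi>)
    have [measurable]: "(\<lambda>\<omega>. network_grad \<phi> \<sigma>\<^sub>w \<sigma>\<^sub>b L n (fst \<omega>) y p) \<in> borel_measurable (?M n)"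
      if "p \<in> params L n" for p and y :: "real^'d"
      using measurable_compose[OF measurable_fst borel_measurable_network_grad[OF \<phi> that]] .
    have [measurable]: "(\<lambda>\<omega>. drop_last_layer L (snd \<omega>) p) \<in> borel_measurable (?M n)"
      if "p \<in> params L n" for p
      using measurable_compose[OF measurable_snd measurable_param[OF that]]
      by (cases "param_layer p = L") (simp_all add: drop_last_layer_def)
    show ?thesis
      unfolding g_tilde_def case_prod_beta' by measurable
  qed
  have conv: "(\<lambda>n. \<integral>\<omega>. c (?T n \<omega>) \<partial>?M n) \<longlonglongrightarrow> (\<integral>\<omega>. c (T \<omega>) \<partial>P)"
    if c: "continuous_on UNIV c" and bound: "\<And>y. \<bar>c y\<bar> \<le> 1" for c :: "real \<Rightarrow> real"
  proof -
    define f where "f h = c (\<Sum>j\<in>J. a j * (fst (h (x j)) - snd (h (x j))))" for h :: "real^'d \<Rightarrow> real \<times> real"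
    have proj: "continuous_map (product_topology (\<lambda>_. euclidean) (x ` J)) euclideanreal (\<lambda>h. q (h (x j)))"
      if "j \<in> J" "continuous_on UNIV q" for j and q :: "real \<times> real \<Rightarrow> real"
      using continuous_map_compose[OF continuous_map_product_projection[of "x j" "x ` J" "\<lambda>_. euclidean"], of euclideanreal q] that
      by (simp add: comp_def)
    have "continuous_map (product_topology (\<lambda>_. euclidean) (x ` J)) euclideanreal
        (\<lambda>h. \<Sum>j\<in>J. a j * (fst (h (x j)) - snd (h (x j))))"
      by (intro continuous_map_sum continuous_map_real_mult_left continuous_map_diff proj J continuous_intros)
    from continuous_map_compose[OF this, of euclideanreal c] c
    have "continuous_map (product_topology (\<lambda>_. euclidean) (x ` J)) euclideanreal f"
      by (simp add: f_def[abs_def] comp_def)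
    moreover have "bounded (f ` (x ` J \<rightarrow>\<^sub>E UNIV))"
      using bound by (auto simp: bounded_iff f_def)
    moreover have "finite (x ` J)"
      using J by simp
    ultimately have "(\<lambda>n. \<integral>\<omega>. f (\<lambda>i\<in>x ` J. case \<omega> of (\<theta>, \<psi>) \<Rightarrow> (network \<phi> \<sigma>\<^sub>w \<sigma>\<^sub>b L n \<theta> i, g_tilde \<phi> \<sigma>\<^sub>w \<sigma>\<^sub>b L n \<theta> \<psi> i)) \<partial>?M n)
        \<longlonglongrightarrow> (\<integral>\<omega>. f (\<lambda>i\<in>x ` J. (U i \<omega>, G i \<omega>)) \<partial>P)"
      using lim unfolding infinite_width_limit_def fidi_converges_def by blast
    moreover have "f (\<lambda>i\<in>x ` J. case \<omega> of (\<theta>, \<psi>) \<Rightarrow> (network \<phi> \<sigma>\<^sub>w \<sigma>\<^sub>b L n \<theta> i, g_tilde \<phi> \<sigma>\<^sub>w \<sigma>\<^sub>b L n \<theta> \<psi> i)) = c (?T n \<omega>)" for n \<omega>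
      unfolding f_def case_prod_beta' by (intro arg_cong[where f = c] sum.cong) simp_all
    moreover have "f (\<lambda>i\<in>x ` J. (U i \<omega>, G i \<omega>)) = c (T \<omega>)" for \<omega>
      unfolding f_def T_def by (intro arg_cong[where f = c] sum.cong) simp_all
    ultimately show ?thesis
      by simp
  qed
  have iexp_split: "(\<integral>\<omega>. iexp (X \<omega>) \<partial>Q) = complex_of_real (\<integral>\<omega>. cos (X \<omega>) \<partial>Q) + \<i> * complex_of_real (\<integral>\<omega>. sin (X \<omega>) \<partial>Q)"
    if "prob_space Q" and [measurable]: "X \<in> borel_measurable Q" for Q :: "'z measure" and X
  proof -
    interpret prob_space Q by fact
    have [simp]: "integrable Q (\<lambda>\<omega>. cos (X \<omega>))" "integrable Q (\<lambda>\<omega>. sin (X \<omega>))"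
      by (rule integrable_const_bound[of _ 1]; simp)+
    have "iexp (X \<omega>) = complex_of_real (cos (X \<omega>)) + \<i> * complex_of_real (sin (X \<omega>))" for \<omega>
      by (simp add: cis_conv_exp[symmetric] complex_eq_iff)
    then show ?thesis by simp
  qed
  have "(\<lambda>n. complex_of_real (\<integral>\<omega>. cos (?T n \<omega>) \<partial>?M n) + \<i> * complex_of_real (\<integral>\<omega>. sin (?T n \<omega>) \<partial>?M n))
      \<longlonglongrightarrow> complex_of_real (\<integral>\<omega>. cos (T \<omega>) \<partial>P) + \<i> * complex_of_real (\<integral>\<omega>. sin (T \<omega>) \<partial>P)"
    by (intro tendsto_intros conv continuous_intros) auto
  moreover have "(\<integral>\<omega>. iexp (?T n \<omega>) \<partial>?M n) =
      complex_of_real (\<integral>\<omega>. cos (?T n \<omega>) \<partial>?M n) + \<i> * complex_of_real (\<integral>\<omega>. sin (?T n \<omega>) \<partial>?M n)" for n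
    by (intro iexp_split Tn_meas prob_space_pair prob_space_init_measure)
  ultimately have "(\<lambda>n. \<integral>\<omega>. iexp (?T n \<omega>) \<partial>?M n) \<longlonglongrightarrow> (\<integral>\<omega>. iexp (T \<omega>) \<partial>P)"
    unfolding iexp_split[OF P.prob_space_axioms T_meas] by (simp only:)
  moreover have "(\<lambda>n. \<integral>\<omega>. iexp (?T n \<omega>) \<partial>?M n)
      \<longlonglongrightarrow> complex_of_real (exp (- (\<Sum>i\<in>J. \<Sum>j\<in>J. a i * a j * \<Theta> (x i) (x j)) / 2))"
    using char_network_g_tilde_tendsto[OF \<phi> L J layer_limits ntk, of a x] unfolding case_prod_beta' .
  ultimately show ?thesis
    unfolding T_def by (rule LIMSEQ_unique)
qed

section \<open>Gaussian process regression and the main result\<close>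

lemma has_covariance_distr:
  assumes [measurable]: "g \<in> M \<rightarrow>\<^sub>M N" "X \<in> borel_measurable N" "Y \<in> borel_measurable N"
    and "has_covariance M (\<lambda>\<omega>. X (g \<omega>)) (\<lambda>\<omega>. Y (g \<omega>)) c"
  shows "has_covariance (distr M N g) X Y c"
  using assms(4) by (simp add: has_covariance_def integrable_distr_eq integral_distr)

text \<open>Equality is asked for on the sample space only, since the flow and its initial value are
  given only there.\<close>

lemma centered_gaussian_process_cong:
  assumes gp: "centered_gaussian_process M X k"
    and eq: "\<And>i \<omega>. \<omega> \<in> space M \<Longrightarrow> X i \<omega> = Y i \<omega>"
  shows "centered_gaussian_process M Y k"
proof -
  have "(Y i \<in> borel_measurable M) = (X i \<in> borel_measurable M)" for i
    by (rule measurable_cong) (simp add: eq)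
  moreover have "distr M borel (\<lambda>\<omega>. \<Sum>i\<in>I. a i * Y i \<omega>) = distr M borel (\<lambda>\<omega>. \<Sum>i\<in>I. a i * X i \<omega>)" for I a
    by (intro distr_cong) (simp_all add: eq)
  ultimately have "gaussian_process M Y"
    using gp by (simp add: centered_gaussian_process_def gaussian_process_def)
  moreover have "(\<integral>\<omega>. X i \<omega> \<partial>M) = 0" for i
    using gp by (simp add: centered_gaussian_process_def)
  moreover from this have "(\<integral>\<omega>. Y i \<omega> \<partial>M) = 0" for i
    using Bochner_Integration.integral_cong[OF refl, of M "X i" "Y i"] by (simp add: eq)
  moreover have "has_covariance M (X i) (X j) (k i j)" for i j
    using gp by (simp add: centered_gaussian_process_def)
  moreover have "integrable M (\<lambda>\<omega>. (Y i \<omega>)\<^sup>2) = integrable M (\<lambda>\<omega>. (X i \<omega>)\<^sup>2)"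
    "(\<integral>\<omega>. Y i \<omega> * Y j \<omega> \<partial>M) = (\<integral>\<omega>. X i \<omega> * X j \<omega> \<partial>M)" for i j
    by (intro Bochner_Integration.integrable_cong Bochner_Integration.integral_cong refl; simp add: eq)+
  ultimately show ?thesis
    by (simp add: centered_gaussian_process_def gaussian_process_def has_covariance_centered_iff)
qed

lemma borel_measurable_vec_lambda:
  fixes f :: "'n::finite \<Rightarrow> 'a \<Rightarrow> real"
  assumes "\<And>i. f i \<in> borel_measurable M"
  shows "(\<lambda>x. \<chi> i. f i x) \<in> borel_measurable M"
  unfolding borel_measurable_euclidean_space[of "\<lambda>x. \<chi> i. f i x"]
  using assms by (auto simp: Basis_vec_def inner_axis)

text \<open>The matrix algebra depends on the kernel and the points alone. Separating it from the
  random process gives the training error and the prior literally the same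
  \<open>posterior_cov\<close>. Symmetry of the whole kernel serves to exchange the training and
  test blocks.\<close>

locale noise_free_regression =
  fixes \<Theta> :: "'x \<Rightarrow> 'x \<Rightarrow> real" and X :: "'m::finite \<Rightarrow> 'x" and X\<^sub>T :: "'k::finite \<Rightarrow> 'x"
  assumes sym: "\<And>x y. \<Theta> x y = \<Theta> y x"
    and pos_def: "positive_definite (kernel_matrix \<Theta> X X)"
begin

text \<open>The coefficients of the best linear predictor of the test values from the training
  values.\<close>

definition gain :: "real^'m^'k" where
  "gain = kernel_matrix \<Theta> X\<^sub>T X ** matrix_inv (kernel_matrix \<Theta> X X)"

text \<open>The Schur complement of the training block in the joint kernel matrix.\<close>

definition posterior_cov :: "real^'k^'k" where
  "posterior_cov = kernel_matrix \<Theta> X\<^sub>T X\<^sub>T - gain ** kernel_matrix \<Theta> X X\<^sub>T"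

text \<open>Completing the square. \<open>w\<close> collects the coefficients of the training values
  once the residual is written out; the disappearance of all terms mixing \<open>s\<close> and
  \<open>t\<close> is the uncorrelatedness of residual and observation.\<close>

lemma posterior_cov_quadratic_form:
  fixes t :: "real^'k" and s :: "real^'m"
  defines "w \<equiv> s - t v* gain"
  shows "t \<bullet> (kernel_matrix \<Theta> X\<^sub>T X\<^sub>T *v t) + 2 * (w \<bullet> (kernel_matrix \<Theta> X X\<^sub>T *v t)) + w \<bullet> (kernel_matrix \<Theta> X X *v w) =
    t \<bullet> (posterior_cov *v t) + s \<bullet> (kernel_matrix \<Theta> X X *v s)"
proof -
  define A where "A = kernel_matrix \<Theta> X X"
  define K where "K = kernel_matrix \<Theta> X X\<^sub>T"
  have A_sym: "transpose A = A"
    using pos_def by (simp add: positive_definite_def A_def)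
  have K_tr: "transpose (kernel_matrix \<Theta> X\<^sub>T X) = K"
    by (simp add: K_def kernel_matrix_def transpose_def vec_eq_iff sym)
  have "A ** transpose (matrix_inv A) = transpose (matrix_inv A ** A)"
    by (simp add: matrix_transpose_mul A_sym)
  also have "\<dots> = mat 1"
    unfolding A_def by (simp add: matrix_inv_mult(1) positive_definite_invertible pos_def transpose_mat)
  finally have inv: "A ** transpose (matrix_inv A) = mat 1" .
  have "t v* gain = (transpose (matrix_inv A) ** K) *v t"
    by (simp add: gain_def A_def[symmetric] matrix_transpose_mul K_tr flip: transpose_matrix_vector)
  \<comment> \<open>The normal equations of the regression, responsible for every cancellation
    below.\<close>
  then have Aw: "A *v (t v* gain) = K *v t"
    by (simp add: matrix_vector_mul_assoc matrix_mul_assoc inv)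
  have sA: "u \<bullet> (A *v v) = (A *v u) \<bullet> v" for u v
    by (metis A_sym dot_lmul_matrix transpose_matrix_vector)
  have tg: "(t v* gain) \<bullet> (K *v t) = t \<bullet> ((gain ** K) *v t)"
    by (simp add: dot_lmul_matrix matrix_vector_mul_assoc)
  have "w \<bullet> (A *v w) = s \<bullet> (A *v s) - 2 * (s \<bullet> (K *v t)) + t \<bullet> ((gain ** K) *v t)"
  proof -
    have "w \<bullet> (A *v w) = s \<bullet> (A *v s) - s \<bullet> (A *v (t v* gain)) - (t v* gain) \<bullet> (A *v s) + (t v* gain) \<bullet> (A *v (t v* gain))"
      by (simp add: w_def matrix_vector_mult_diff_distrib inner_diff_left inner_diff_right)
    moreover have "(t v* gain) \<bullet> (A *v s) = s \<bullet> (K *v t)"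
      using sA[of "t v* gain" s] by (simp add: Aw inner_commute)
    ultimately show ?thesis
      by (simp add: Aw tg)
  qed
  moreover have "w \<bullet> (K *v t) = s \<bullet> (K *v t) - t \<bullet> ((gain ** K) *v t)"
    by (simp add: w_def inner_diff_left tg)
  moreover have "t \<bullet> (posterior_cov *v t) = t \<bullet> (kernel_matrix \<Theta> X\<^sub>T X\<^sub>T *v t) - t \<bullet> ((gain ** K) *v t)"
    by (simp add: posterior_cov_def K_def[symmetric] matrix_vector_mult_diff_rdistrib inner_diff_right)
  ultimately show ?thesis
    by (simp add: A_def K_def)
qed

lemma posterior_cov_sym: "posterior_cov $ i $ j = posterior_cov $ j $ i"
proof -
  define A where "A = kernel_matrix \<Theta> X X"
  define K where "K = kernel_matrix \<Theta> X X\<^sub>T"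
  have A_sym: "transpose A = A"
    using pos_def by (simp add: positive_definite_def A_def)
  have K_tr: "transpose K = kernel_matrix \<Theta> X\<^sub>T X" "transpose (kernel_matrix \<Theta> X\<^sub>T X\<^sub>T) = kernel_matrix \<Theta> X\<^sub>T X\<^sub>T"
    by (simp_all add: K_def kernel_matrix_def transpose_def vec_eq_iff sym)
  note inv = matrix_inv_mult[OF positive_definite_invertible[OF pos_def], folded A_def]
  have "transpose (matrix_inv A) = transpose (matrix_inv A) ** (A ** matrix_inv A)"
    by (simp add: inv)
  also have "\<dots> = transpose (A ** matrix_inv A) ** matrix_inv A"
    by (simp add: matrix_transpose_mul A_sym matrix_mul_assoc)
  also have "\<dots> = matrix_inv A"
    by (simp add: inv transpose_mat)
  finally have "transpose (gain ** K) = gain ** K"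
    by (simp add: gain_def A_def[symmetric] K_tr(1)[symmetric] matrix_transpose_mul matrix_mul_assoc)
  then have "transpose posterior_cov = posterior_cov"
    unfolding posterior_cov_def K_def[symmetric] using K_tr(2) by (simp add: transpose_def vec_eq_iff)
  then show ?thesis
    by (metis (no_types, lifting) transpose_def vec_lambda_beta)
qed

end

text \<open>Gaussianity enters through characteristic functions because both the infinite-width
  limit and a Gaussian prior provide them. The sum type indexes test and training points jointly,
  with repetitions allowed.\<close>

locale gaussian_regression = noise_free_regression \<Theta> X X\<^sub>T
  for \<Theta> :: "'x \<Rightarrow> 'x \<Rightarrow> real" and X :: "'m::finite \<Rightarrow> 'x" and X\<^sub>T :: "'k::finite \<Rightarrow> 'x" +
  fixes M :: "'w measure" and D :: "'x \<Rightarrow> 'w \<Rightarrow> real"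
  assumes M: "prob_space M"
    and D: "\<And>x. D x \<in> borel_measurable M"
    and D_char: "\<And>(a :: 'k + 'm \<Rightarrow> real) Y. (\<integral>\<omega>. iexp (\<Sum>j\<in>UNIV. a j * D (Y j) \<omega>) \<partial>M) =
      complex_of_real (exp (- (\<Sum>i\<in>UNIV. \<Sum>j\<in>UNIV. a i * a j * \<Theta> (Y i) (Y j)) / 2))"
begin

definition observed :: "'w \<Rightarrow> real^'m" where "observed \<omega> = (\<chi> j. D (X j) \<omega>)"

definition residual :: "'w \<Rightarrow> real^'k" where
  "residual \<omega> = (\<chi> i. D (X\<^sub>T i) \<omega>) - gain *v observed \<omega>"

lemma borel_measurable_observed [measurable]: "observed \<in> borel_measurable M"
  unfolding observed_def using D by (rule borel_measurable_vec_lambda)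

lemma borel_measurable_residual [measurable]: "residual \<in> borel_measurable M"
proof -
  have "(\<lambda>\<omega>. (\<chi> i. D (X\<^sub>T i) \<omega>) :: real^'k) \<in> borel_measurable M"
    using D by (rule borel_measurable_vec_lambda)
  moreover have "(\<lambda>y. gain *v y) \<in> borel_measurable borel"
    by (intro borel_measurable_continuous_onI linear_continuous_on matrix_vector_mul_bounded_linear)
  ultimately show ?thesis
    unfolding residual_def by (intro borel_measurable_diff) (auto intro: measurable_compose[OF borel_measurable_observed])
qed

text \<open>The whole regression is contained in this formula: \<open>s = 0\<close> gives the law of
  the residual, and the product form gives its independence of the observations.\<close>

lemma residual_observed_char:
  "(\<integral>\<omega>. iexp (s \<bullet> observed \<omega> + t \<bullet> residual \<omega>) \<partial>M) =
    complex_of_real (exp (- (s \<bullet> (kernel_matrix \<Theta> X X *v s)) / 2)) * complex_of_real (exp (- (t \<bullet> (posterior_cov *v t)) / 2))"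
proof -
  define w where "w = s - t v* gain"
  define a where "a = case_sum (\<lambda>i. t $ i) (\<lambda>j. w $ j)"
  define Y where "Y = case_sum X\<^sub>T X"
  have sum_Plus: "(\<Sum>j\<in>UNIV. f j) = (\<Sum>i\<in>UNIV. f (Inl i)) + (\<Sum>j\<in>UNIV. f (Inr j))" for f :: "'k + 'm \<Rightarrow> real"
    using sum.Plus[of UNIV UNIV f] by (simp add: comp_def)
  have "s \<bullet> observed \<omega> + t \<bullet> residual \<omega> = (\<Sum>j\<in>UNIV. a j * D (Y j) \<omega>)" for \<omega>
  proof -
    have "s \<bullet> observed \<omega> + t \<bullet> residual \<omega> = t \<bullet> (\<chi> i. D (X\<^sub>T i) \<omega>) + w \<bullet> observed \<omega>"
      by (simp add: residual_def w_def inner_diff_left inner_diff_right dot_lmul_matrix)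
    then show ?thesis
      by (simp add: sum_Plus a_def Y_def inner_vec_def observed_def)
  qed
  moreover have "(\<Sum>i\<in>UNIV. \<Sum>j\<in>UNIV. a i * a j * \<Theta> (Y i) (Y j)) =
      t \<bullet> (posterior_cov *v t) + s \<bullet> (kernel_matrix \<Theta> X X *v s)"
  proof -
    have form: "(\<Sum>i\<in>UNIV. \<Sum>j\<in>UNIV. p $ i * q $ j * \<Theta> (A i) (B j)) = p \<bullet> (kernel_matrix \<Theta> A B *v q)"
      for p :: "real^'a::finite" and q :: "real^'b::finite" and A B
      by (simp add: inner_vec_def matrix_vector_mult_def kernel_matrix_def sum_distrib_left mult_ac)
    have "t \<bullet> (kernel_matrix \<Theta> X\<^sub>T X *v w) = w \<bullet> (kernel_matrix \<Theta> X X\<^sub>T *v t)"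
      unfolding form[symmetric] by (subst sum.swap) (simp add: sym mult_ac)
    then show ?thesis
      unfolding posterior_cov_quadratic_form[symmetric] w_def[symmetric]
      by (simp add: sum_Plus a_def Y_def form sum.distrib)
  qed
  ultimately have "(\<integral>\<omega>. iexp (s \<bullet> observed \<omega> + t \<bullet> residual \<omega>) \<partial>M) =
      complex_of_real (exp (- (t \<bullet> (posterior_cov *v t) + s \<bullet> (kernel_matrix \<Theta> X X *v s)) / 2))"
    using D_char[of a Y] by simp
  then show ?thesis
    by (simp add: exp_add[symmetric] add_divide_distrib flip: of_real_mult)
qed

lemma residual_centered_gaussian_process:
  "centered_gaussian_process M (\<lambda>i \<omega>. residual \<omega> $ i) (\<lambda>i j. posterior_cov $ i $ j)"
proof (rule centered_gaussian_processI[OF M _ posterior_cov_sym])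
  show "(\<lambda>\<omega>. residual \<omega> $ i) \<in> borel_measurable M" for i
    by (rule measurable_compose[OF borel_measurable_residual borel_measurable_nth])
  fix I :: "'k set" and a :: "'k \<Rightarrow> real"
  \<comment> \<open>Extending the coefficients by 0 turns a combination over \<open>I\<close> into
    an inner product with the full residual vector.\<close>
  define t :: "real^'k" where "t = (\<chi> i. if i \<in> I then a i else 0)"
  have "t \<bullet> residual \<omega> = (\<Sum>i\<in>I. a i * residual \<omega> $ i)" for \<omega>
    unfolding inner_vec_def t_def by (rule sum.mono_neutral_cong_right) auto
  moreover have "t \<bullet> (posterior_cov *v t) = (\<Sum>i\<in>I. \<Sum>j\<in>I. a i * a j * posterior_cov $ i $ j)"
  proof -
    have "t \<bullet> (posterior_cov *v t) = (\<Sum>i\<in>UNIV. \<Sum>j\<in>UNIV. t $ i * t $ j * posterior_cov $ i $ j)"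
      by (simp add: inner_vec_def matrix_vector_mult_def sum_distrib_left mult_ac)
    also have "\<dots> = (\<Sum>i\<in>I. \<Sum>j\<in>UNIV. t $ i * t $ j * posterior_cov $ i $ j)"
      by (rule sum.mono_neutral_right) (auto simp: t_def)
    also have "\<dots> = (\<Sum>i\<in>I. \<Sum>j\<in>I. a i * a j * posterior_cov $ i $ j)"
      by (intro sum.cong refl sum.mono_neutral_cong_right) (auto simp: t_def)
    finally show ?thesis .
  qed
  ultimately show "(\<integral>\<omega>. iexp (\<Sum>i\<in>I. a i * residual \<omega> $ i) \<partial>M) =
      complex_of_real (exp (- (\<Sum>i\<in>I. \<Sum>j\<in>I. a i * a j * posterior_cov $ i $ j) / 2))"
    using residual_observed_char[of 0 t] by simp
qed

lemma residual_observed_independent: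
  "distr M borel (\<lambda>\<omega>. (observed \<omega>, residual \<omega>)) = distr M borel observed \<Otimes>\<^sub>M distr M borel residual"
proof (rule joint_law_eq_pair_measureI[OF M])
  fix s :: "real^'m" and t :: "real^'k"
  show "(\<integral>\<omega>. iexp (s \<bullet> observed \<omega> + t \<bullet> residual \<omega>) \<partial>M) =
      (\<integral>\<omega>. iexp (s \<bullet> observed \<omega>) \<partial>M) * (\<integral>\<omega>. iexp (t \<bullet> residual \<omega>) \<partial>M)"
    using residual_observed_char[of s t] residual_observed_char[of s 0] residual_observed_char[of 0 t] by simp
qed measurable

text \<open>The test values are the independent residual plus the posterior mean
  \<open>gain *v y\<close> evaluated at the observation.\<close>

lemma regular_conditional_distribution_residual_shift:
  "regular_conditional_distribution M observed (\<lambda>\<omega>. \<chi> i. D (X\<^sub>T i) \<omega>)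
    (\<lambda>y. distr (distr M borel residual) borel (\<lambda>z. z + gain *v y))"
proof -
  have "(\<lambda>\<omega>. \<chi> i. D (X\<^sub>T i) \<omega>) = (\<lambda>\<omega>. residual \<omega> + gain *v observed \<omega>)"
    by (simp add: residual_def)
  moreover have "(\<lambda>y. gain *v y) \<in> borel_measurable borel"
    by (intro borel_measurable_continuous_onI linear_continuous_on matrix_vector_mul_bounded_linear)
  ultimately show ?thesis
    using regular_conditional_distribution_shift[OF M _ _ _ residual_observed_independent] by simp
qed

text \<open>Every version agrees almost surely with the shifted law of the residual, and a shift
  leaves covariances alone; hence the same matrix for almost every observation.\<close>

lemma has_covariance_regular_conditional_distribution:
  assumes "regular_conditional_distribution M observed (\<lambda>\<omega>. \<chi> i. D (X\<^sub>T i) \<omega>) \<kappa>"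
  shows "AE y in distr M borel observed. \<forall>i j. has_covariance (\<kappa> y) (\<lambda>v. v $ i) (\<lambda>v. v $ j) (posterior_cov $ i $ j)"
proof -
  have cov: "has_covariance (distr (distr M borel residual) borel (\<lambda>z. z + b)) (\<lambda>v. v $ i) (\<lambda>v. v $ j) (posterior_cov $ i $ j)" for b i j
  proof (intro has_covariance_distr)
    have "has_covariance M (\<lambda>\<omega>. residual \<omega> $ i) (\<lambda>\<omega>. residual \<omega> $ j) (posterior_cov $ i $ j)"
      using residual_centered_gaussian_process by (simp add: centered_gaussian_process_def)
    from has_covariance_add_const[OF M this]
    show "has_covariance M (\<lambda>\<omega>. (residual \<omega> + b) $ i) (\<lambda>\<omega>. (residual \<omega> + b) $ j) (posterior_cov $ i $ j)"
      by simp
  qed (auto intro!: borel_measurable_continuous_onI continuous_intros)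
  have "AE y in distr M borel observed. \<kappa> y = distr (distr M borel residual) borel (\<lambda>z. z + gain *v y)"
    by (rule regular_conditional_distribution_AE_unique[OF M borel_measurable_observed assms
          regular_conditional_distribution_residual_shift])
  then show ?thesis
    by eventually_elim (simp add: cov)
qed

end

text \<open>\<open>Lim\<close> is a total operator, so convergence of the flow is part of the claim.
  Conditional distributions are determined only almost surely, so the covariance is asserted for
  every version; their existence keeps this from being vacuous.\<close>

theorem theorem4p2:
  fixes \<phi> :: "real \<Rightarrow> real" and \<sigma>\<^sub>w \<sigma>\<^sub>b :: real and L :: nat
    and \<Theta> :: "real^'d \<Rightarrow> real^'d \<Rightarrow> real"
    and X :: "'m::finite \<Rightarrow> real^'d"
    and X\<^sub>T :: "'k::finite \<Rightarrow> real^'d"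
    and P :: "'w measure"
    and U G :: "real^'d \<Rightarrow> 'w \<Rightarrow> real"
    and u :: "real \<Rightarrow> real^'d \<Rightarrow> 'w \<Rightarrow> real"
    and u_inf \<epsilon> :: "real^'d \<Rightarrow> 'w \<Rightarrow> real"
    and \<Sigma> :: "real^'k^'k"
  assumes lipschitz: "\<exists>C. C-lipschitz_on UNIV \<phi>"
    and layers: "1 \<le> L"
    and layer_limits: "layer_ntk_limits_exist TYPE('d) \<phi> \<sigma>\<^sub>w \<sigma>\<^sub>b L"
    and ntk: "is_ntk \<phi> \<sigma>\<^sub>w \<sigma>\<^sub>b L \<Theta>"
    and pos_def: "positive_definite (kernel_matrix \<Theta> X X)"
    and init_limit: "infinite_width_limit \<phi> \<sigma>\<^sub>w \<sigma>\<^sub>b L P U G"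
    and flow_init: "\<And>\<omega> x. \<omega> \<in> space P \<Longrightarrow> u 0 x \<omega> = U x \<omega>"
    and flow: "\<And>\<omega>. \<omega> \<in> space P \<Longrightarrow>
       ntk_gradient_flow \<Theta> X (\<lambda>j. G (X j) \<omega>) (\<lambda>t x. u t x \<omega>)"
  defines "u_inf \<equiv> \<lambda>x \<omega>. Lim at_top (\<lambda>t. u t x \<omega>)"
    and "\<epsilon> \<equiv> \<lambda>x \<omega>. u_inf x \<omega> - G x \<omega>"
    and "\<Sigma> \<equiv> kernel_matrix \<Theta> X\<^sub>T X\<^sub>T -
       kernel_matrix \<Theta> X\<^sub>T X ** matrix_inv (kernel_matrix \<Theta> X X) ** kernel_matrix \<Theta> X X\<^sub>T"
  shows "(\<forall>\<omega>\<in>space P. \<forall>x. ((\<lambda>t. u t x \<omega>) \<longlongrightarrow> u_inf x \<omega>) at_top) \<and>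
     centered_gaussian_process P (\<lambda>i. \<epsilon> (X\<^sub>T i)) (\<lambda>i j. \<Sigma> $ i $ j) \<and>
     (\<forall>(N :: 'p measure) F. prob_space N \<and> centered_gaussian_process N F \<Theta> \<longrightarrow>
       (\<exists>\<kappa>. regular_conditional_distribution N (\<lambda>\<omega>. \<chi> j. F (X j) \<omega>) (\<lambda>\<omega>. \<chi> i. F (X\<^sub>T i) \<omega>) \<kappa>) \<and>
       (\<forall>\<kappa>. regular_conditional_distribution N (\<lambda>\<omega>. \<chi> j. F (X j) \<omega>) (\<lambda>\<omega>. \<chi> i. F (X\<^sub>T i) \<omega>) \<kappa> \<longrightarrow>
          (AE y in distr N borel (\<lambda>\<omega>. \<chi> j. F (X j) \<omega>). \<forall>i j.
             has_covariance (\<kappa> y) (\<lambda>v. v $ i) (\<lambda>v. v $ j) (\<Sigma> $ i $ j))))"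
proof (intro conjI allI impI ballI)
  obtain C where "C-lipschitz_on UNIV \<phi>"
    using lipschitz by blast
  then have \<phi>: "continuous_on UNIV \<phi>"
    by (rule lipschitz_on_continuous_on)
  define D where "D x \<omega> = U x \<omega> - G x \<omega>" for x \<omega>
  interpret noise_free_regression \<Theta> X X\<^sub>T
    by unfold_locales (rule is_ntk_sym[OF \<phi> ntk], rule pos_def)
  interpret D: gaussian_regression \<Theta> X X\<^sub>T P D
  proof (rule gaussian_regression.intro[OF noise_free_regression_axioms gaussian_regression_axioms.intro])
    show "prob_space P" "\<And>x. D x \<in> borel_measurable P"
      using init_limit unfolding D_def[abs_def] by (simp_all add: infinite_width_limit_def borel_measurable_diff)
    show "(\<integral>\<omega>. iexp (\<Sum>j\<in>UNIV. a j * D (Y j) \<omega>) \<partial>P) =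
      complex_of_real (exp (- (\<Sum>i\<in>UNIV. \<Sum>j\<in>UNIV. a i * a j * \<Theta> (Y i) (Y j)) / 2))" for a :: "'k + 'm \<Rightarrow> real" and Y
      unfolding D_def by (rule infinite_width_limit_char[OF \<phi> layers finite layer_limits ntk init_limit])
  qed
  have \<Sigma>: "\<Sigma> = posterior_cov"
    unfolding \<Sigma>_def posterior_cov_def gain_def ..
  have lim: "((\<lambda>t. u t x \<omega>) \<longlongrightarrow> U x \<omega> -
      (\<Sum>j\<in>UNIV. \<Theta> x (X j) * (matrix_inv (kernel_matrix \<Theta> X X) *v D.observed \<omega>) $ j)) at_top"
    if "\<omega> \<in> space P" for x \<omega>
    using ntk_gradient_flow_limit[OF pos_def flow[OF that], of x] flow_init[OF that]
    by (simp add: D_def D.observed_def)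
  have u_inf: "u_inf x \<omega> = U x \<omega> - (\<Sum>j\<in>UNIV. \<Theta> x (X j) * (matrix_inv (kernel_matrix \<Theta> X X) *v D.observed \<omega>) $ j)"
    if "\<omega> \<in> space P" for x \<omega>
    unfolding u_inf_def by (rule tendsto_Lim[OF trivial_limit_at_top_linorder lim[OF that]])
  show "((\<lambda>t. u t x \<omega>) \<longlongrightarrow> u_inf x \<omega>) at_top" if "\<omega> \<in> space P" for \<omega> x
    unfolding u_inf[OF that] by (rule lim[OF that])
  \<comment> \<open>Subtracting the target from the limit of the flow leaves D(x) minus the
    prediction of D(x) from D at the training points, which is the regression residual of
    \<open>D\<close>.\<close>
  have "\<epsilon> (X\<^sub>T i) \<omega> = D.residual \<omega> $ i" if "\<omega> \<in> space P" for i \<omega>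
  proof -
    have "(gain *v v) $ i = (\<Sum>j\<in>UNIV. \<Theta> (X\<^sub>T i) (X j) * (matrix_inv (kernel_matrix \<Theta> X X) *v v) $ j)" for v
      unfolding gain_def matrix_vector_mul_assoc[symmetric] by (simp add: matrix_vector_mult_def kernel_matrix_def)
    then show ?thesis
      by (simp add: \<epsilon>_def u_inf[OF that] D.residual_def D_def)
  qed
  note \<epsilon> = this
  show "centered_gaussian_process P (\<lambda>i. \<epsilon> (X\<^sub>T i)) (\<lambda>i j. \<Sigma> $ i $ j)"
    unfolding \<Sigma> by (rule centered_gaussian_process_cong[OF D.residual_centered_gaussian_process]) (simp only: \<epsilon>)
  fix N :: "'p measure" and F :: "real^'d \<Rightarrow> 'p \<Rightarrow> real"
  assume NF: "prob_space N \<and> centered_gaussian_process N F \<Theta>"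
  interpret F: gaussian_regression \<Theta> X X\<^sub>T N F
  proof (rule gaussian_regression.intro[OF noise_free_regression_axioms gaussian_regression_axioms.intro])
    show "prob_space N" "\<And>x. F x \<in> borel_measurable N"
      using NF by (auto simp: centered_gaussian_process_def gaussian_process_def)
    show "(\<integral>\<omega>. iexp (\<Sum>j\<in>UNIV. a j * F (Y j) \<omega>) \<partial>N) =
      complex_of_real (exp (- (\<Sum>i\<in>UNIV. \<Sum>j\<in>UNIV. a i * a j * \<Theta> (Y i) (Y j)) / 2))" for a :: "'k + 'm \<Rightarrow> real" and Y
      using NF by (intro centered_gaussian_process_char) auto
  qed
  have observed: "(\<lambda>\<omega>. \<chi> j. F (X j) \<omega>) = F.observed"
    by (rule ext) (simp add: F.observed_def)
  show "\<exists>\<kappa>. regular_conditional_distribution N (\<lambda>\<omega>. \<chi> j. F (X j) \<omega>) (\<lambda>\<omega>. \<chi> i. F (X\<^sub>T i) \<omega>) \<kappa>"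
    unfolding observed by (rule exI, rule F.regular_conditional_distribution_residual_shift)
  show "AE y in distr N borel (\<lambda>\<omega>. \<chi> j. F (X j) \<omega>). \<forall>i j.
             has_covariance (\<kappa> y) (\<lambda>v. v $ i) (\<lambda>v. v $ j) (\<Sigma> $ i $ j)"
    if "regular_conditional_distribution N (\<lambda>\<omega>. \<chi> j. F (X j) \<omega>) (\<lambda>\<omega>. \<chi> i. F (X\<^sub>T i) \<omega>) \<kappa>" for \<kappa>
    unfolding observed \<Sigma>
    by (rule F.has_covariance_regular_conditional_distribution) (rule that[unfolded observed])
qed

end
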